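(* Let $R$ be a ring, $M$ an $R$-$R$-bimodule, $\theta:M\otimes_RM\to M$ an associative $R$-bimodule homomorphism, and $T=R\ltimes_\theta M$ the $\theta$-extension of $R$ by $M$. Let $l=T\otimes_R-:\operatorname{Mod}R\to\operatorname{Mod}T$ and $q=R\otimes_T-:\operatorname{Mod}T\to\operatorname{Mod}R$. Let $(X,\alpha)$ be a left $T$-module and $l(P_1)\xrightarrow{\delta}l(P_0)\to(X,\alpha)\to0$ a projective presentation of it in $\operatorname{Mod}T$, with $P_0,P_1$ projective left $R$-modules. If $(X,\alpha)$ is silting (respectively, partial silting) with respect to $\delta$, then $\operatorname{Coker}(\alpha)$ is a silting (respectively, partial silting) left $R$-module with respect to $q(\delta)$.
   Context: Rings are nonzero, associative with identity; modules are unitary; $\operatorname{Mod}R$ is the category of left $R$-modules. The $\theta$-extension $R\ltimes_\theta M$ is the ring with underlying abelian group $R\oplus M$ and multiplication $(r,m)(r',m')=(rr',\,rm'+mr'+\theta(m\otimes m'))$; $\theta$ associative means $\theta\circ(\theta\otimes 1_M)=\theta\circ(1_M\otimes\theta)$. A left $T$-module is identified with a pair $(X,\alpha)$, where $X$ is a left $R$-module and $\alpha:M\otimes_RX\to X$ is an $R$-homomorphism with $\alpha\circ(1_M\otimes\alpha)=\alpha\circ(\theta\otimes1_X)$. There are ring homomorphisms $R\to T$, $r\mapsto(r,0)$, and $T\to R$, $(r,m)\mapsto r$, making $T$ a $T$-$R$-bimodule and $R$ an $R$-$T$-bimodule. One has $q(X,\alpha)=\operatorname{Coker}\alpha$ and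 $ql\simeq\mathrm{Id}$, so $q(\delta)$ is regarded as a map $P_1\to P_0$ giving the projective presentation $P_1\xrightarrow{q(\delta)}P_0\to\operatorname{Coker}\alpha\to0$. For a morphism $\sigma:X\to Z$ of left modules over a ring, $\mathcal{D}_\sigma$ is the class of modules $L$ such that $\operatorname{Hom}(\sigma,L):\operatorname{Hom}(Z,L)\to\operatorname{Hom}(X,L)$ is surjective. $\operatorname{Gen}(X)$ is the class of quotients of direct sums of copies of $X$. Given a projective presentation $Q_1\xrightarrow{\sigma}Q_0\to X\to0$ (exact, $Q_0,Q_1$ projective), $X$ is partial silting with respect to $\sigma$ if $X\in\mathcal{D}_\sigma$ and $\mathcal{D}_\sigma$ is a torsion class (equivalently, closed under direct sums); $X$ is silting with respect to $\sigma$ if $\operatorname{Gen}(X)=\mathcal{D}_\sigma$. *)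

theory Defs
  imports "HOL-Algebra.Module" "HOL-Algebra.AbelCoset" "HOL-Algebra.Free_Abelian_Groups"
begin

section \<open>Modules and bimodules over noncommutative rings\<close>

text \<open>
  The library's locale \<open>module\<close> requires a commutative ring of scalars. Its record type is reused
  here; as there, the fields \<open>mult\<close> and \<open>one\<close> of a module carry no meaning.
\<close>

locale left_module = R?: ring R + M?: abelian_group M
  for R :: "('r, 'a) ring_scheme" (structure) and M :: "('r, 'm, 'b) module_scheme" (structure) +
  assumes smult_closed [simp, intro]:
      "\<lbrakk>a \<in> carrier R; x \<in> carrier M\<rbrakk> \<Longrightarrow> a \<odot>\<^bsub>M\<^esub> x \<in> carrier M"
    and smult_l_distr:
      "\<lbrakk>a \<in> carrier R; b \<in> carrier R; x \<in> carrier M\<rbrakk> \<Longrightarrow>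
        (a \<oplus> b) \<odot>\<^bsub>M\<^esub> x = a \<odot>\<^bsub>M\<^esub> x \<oplus>\<^bsub>M\<^esub> b \<odot>\<^bsub>M\<^esub> x"
    and smult_r_distr:
      "\<lbrakk>a \<in> carrier R; x \<in> carrier M; y \<in> carrier M\<rbrakk> \<Longrightarrow>
        a \<odot>\<^bsub>M\<^esub> (x \<oplus>\<^bsub>M\<^esub> y) = a \<odot>\<^bsub>M\<^esub> x \<oplus>\<^bsub>M\<^esub> a \<odot>\<^bsub>M\<^esub> y"
    and smult_assoc1:
      "\<lbrakk>a \<in> carrier R; b \<in> carrier R; x \<in> carrier M\<rbrakk> \<Longrightarrow>
        (a \<otimes> b) \<odot>\<^bsub>M\<^esub> x = a \<odot>\<^bsub>M\<^esub> (b \<odot>\<^bsub>M\<^esub> x)"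
    and smult_one [simp]:
      "x \<in> carrier M \<Longrightarrow> \<one> \<odot>\<^bsub>M\<^esub> x = x"

record ('s, 'r, 'm) bimodule = "('s, 'm) module" +
  rsmult :: "['m, 'r] \<Rightarrow> 'm"  (infixl \<open>\<odot>\<^sub>r\<index>\<close> 70)

locale bimodule = L: left_module S M + R: ring R
  for S :: "('s, 'a) ring_scheme" (structure) and R :: "('r, 'b) ring_scheme" (structure)
    and M :: "('s, 'r, 'm, 'c) bimodule_scheme" (structure) +
  assumes rsmult_closed [simp, intro]:
      "\<lbrakk>x \<in> carrier M; a \<in> carrier R\<rbrakk> \<Longrightarrow> x \<odot>\<^sub>r\<^bsub>M\<^esub> a \<in> carrier M"
    and rsmult_r_distr:
      "\<lbrakk>x \<in> carrier M; a \<in> carrier R; b \<in> carrier R\<rbrakk> \<Longrightarrow>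
        x \<odot>\<^sub>r\<^bsub>M\<^esub> (a \<oplus>\<^bsub>R\<^esub> b) = x \<odot>\<^sub>r\<^bsub>M\<^esub> a \<oplus>\<^bsub>M\<^esub> x \<odot>\<^sub>r\<^bsub>M\<^esub> b"
    and rsmult_l_distr:
      "\<lbrakk>x \<in> carrier M; y \<in> carrier M; a \<in> carrier R\<rbrakk> \<Longrightarrow>
        (x \<oplus>\<^bsub>M\<^esub> y) \<odot>\<^sub>r\<^bsub>M\<^esub> a = x \<odot>\<^sub>r\<^bsub>M\<^esub> a \<oplus>\<^bsub>M\<^esub> y \<odot>\<^sub>r\<^bsub>M\<^esub> a"
    and rsmult_assoc1:
      "\<lbrakk>x \<in> carrier M; a \<in> carrier R; b \<in> carrier R\<rbrakk> \<Longrightarrow>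
        x \<odot>\<^sub>r\<^bsub>M\<^esub> (a \<otimes>\<^bsub>R\<^esub> b) = (x \<odot>\<^sub>r\<^bsub>M\<^esub> a) \<odot>\<^sub>r\<^bsub>M\<^esub> b"
    and rsmult_one [simp]:
      "x \<in> carrier M \<Longrightarrow> x \<odot>\<^sub>r\<^bsub>M\<^esub> \<one>\<^bsub>R\<^esub> = x"
    and smult_rsmult_assoc:
      "\<lbrakk>s \<in> carrier S; x \<in> carrier M; a \<in> carrier R\<rbrakk> \<Longrightarrow>
        (s \<odot>\<^bsub>M\<^esub> x) \<odot>\<^sub>r\<^bsub>M\<^esub> a = s \<odot>\<^bsub>M\<^esub> (x \<odot>\<^sub>r\<^bsub>M\<^esub> a)"

text \<open>
  Module homomorphisms are functions on the whole type of which only the values on the carrier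
  matter; accordingly they are compared pointwise on carriers below.
\<close>

definition mod_hom ::
  "[('r, 'a) ring_scheme, ('r, 'x, 'b) module_scheme, ('r, 'y, 'c) module_scheme] \<Rightarrow> ('x \<Rightarrow> 'y) set"
  where "mod_hom R X Y =
    {f \<in> hom (add_monoid X) (add_monoid Y).
       \<forall>r\<in>carrier R. \<forall>x\<in>carrier X. f (r \<odot>\<^bsub>X\<^esub> x) = r \<odot>\<^bsub>Y\<^esub> f x}"

definition bimod_hom ::
  "[('s, 'a) ring_scheme, ('r, 'b) ring_scheme,
    ('s, 'r, 'x, 'c) bimodule_scheme, ('s, 'r, 'y, 'd) bimodule_scheme] \<Rightarrow> ('x \<Rightarrow> 'y) set"
  where "bimod_hom S R X Y =
    {f \<in> mod_hom S X Y. \<forall>x\<in>carrier X. \<forall>r\<in>carrier R. f (x \<odot>\<^sub>r\<^bsub>X\<^esub> r) = f x \<odot>\<^sub>r\<^bsub>Y\<^esub> r}"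

text \<open>The ring \<open>B\<close> as a \<open>B\<close>-\<open>A\<close>-bimodule via a ring homomorphism \<open>f\<close> from \<open>A\<close> to \<open>B\<close>.\<close>

definition ring_bimodule :: "[('b, 'c) ring_scheme, 'a \<Rightarrow> 'b] \<Rightarrow> ('b, 'a, 'b) bimodule"
  where "ring_bimodule B f =
    \<lparr>carrier = carrier B, mult = mult B, one = \<one>\<^bsub>B\<^esub>, ring.zero = \<zero>\<^bsub>B\<^esub>, add = add B,
     smult = mult B, rsmult = (\<lambda>b a. b \<otimes>\<^bsub>B\<^esub> f a)\<rparr>"

definition quot_module :: "[('r, 'x, 'a) module_scheme, 'x set] \<Rightarrow> ('r, 'x set) module"
  where "quot_module X N =
    \<lparr>carrier = a_rcosets\<^bsub>X\<^esub> N, mult = undefined, one = undefined, ring.zero = N, add = set_add X,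
     smult = (\<lambda>r C. N <+>\<^bsub>X\<^esub> (\<lambda>x. r \<odot>\<^bsub>X\<^esub> x) ` C)\<rparr>"

definition coker ::
  "[('r, 'y, 'b) module_scheme, ('r, 'x, 'a) module_scheme, 'y \<Rightarrow> 'x] \<Rightarrow> ('r, 'x set) module"
  where "coker Y X f = quot_module X (f ` carrier Y)"

definition direct_sum ::
  "['i set, 'i \<Rightarrow> ('r, 'x, 'a) module_scheme] \<Rightarrow> ('r, 'i \<Rightarrow> 'x) module"
  where "direct_sum I L =
    (let G = sum_group I (\<lambda>i. add_monoid (L i)) in
     \<lparr>carrier = carrier G, mult = undefined, one = undefined, ring.zero = \<one>\<^bsub>G\<^esub>, add = mult G,
      smult = (\<lambda>r x. \<lambda>i\<in>I. r \<odot>\<^bsub>L i\<^esub> x i)\<rparr>)"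

text \<open>
  Projective means direct summand of a free module. Index sets of elements of \<open>P\<close> suffice: a
  direct summand of some free module is one of the free module on its own carrier.
\<close>

definition projective :: "[('r, 'a) ring_scheme, ('r, 'p, 'b) module_scheme] \<Rightarrow> bool"
  where "projective R P \<longleftrightarrow> left_module R P \<and>
    (\<exists>(I :: 'p set). \<exists>i \<in> mod_hom R P (direct_sum I (\<lambda>_. ring_bimodule R id)).
       \<exists>p \<in> mod_hom R (direct_sum I (\<lambda>_. ring_bimodule R id)) P. \<forall>x\<in>carrier P. p (i x) = x)"

definition projective_presentation ::
  "[('r, 'a) ring_scheme, ('r, 'y, 'b) module_scheme, 'y \<Rightarrow> 'z,
    ('r, 'z, 'c) module_scheme, 'z \<Rightarrow> 'x, ('r, 'x, 'd) module_scheme] \<Rightarrow> bool"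
  where "projective_presentation R Q1 \<sigma> Q0 \<pi> X \<longleftrightarrow>
    projective R Q1 \<and> projective R Q0 \<and> left_module R X \<and>
    \<sigma> \<in> mod_hom R Q1 Q0 \<and> \<pi> \<in> mod_hom R Q0 X \<and>
    \<sigma> ` carrier Q1 = a_kernel Q0 X \<pi> \<and> \<pi> ` carrier Q0 = carrier X"


section \<open>Tensor products\<close>

text \<open>
  For an \<open>S\<close>-\<open>R\<close>-bimodule \<open>M\<close> and a left \<open>R\<close>-module \<open>X\<close>, the left \<open>S\<close>-module \<open>M \<otimes>\<^sub>R X\<close> is the
  free abelian group on the pairs \<open>(m, x)\<close> modulo the subgroup \<open>tensor_rel R M X\<close>.
\<close>

definition tensor_rel ::
  "[('r, 'a) ring_scheme, ('s, 'r, 'm, 'b) bimodule_scheme, ('r, 'x, 'c) module_scheme]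
    \<Rightarrow> ('m \<times> 'x \<Rightarrow>\<^sub>0 int) set"
  where "tensor_rel R M X =
    generate (free_Abelian_group (carrier M \<times> carrier X))
     ({frag_of (m \<oplus>\<^bsub>M\<^esub> m', x) - frag_of (m, x) - frag_of (m', x) | m m' x.
         m \<in> carrier M \<and> m' \<in> carrier M \<and> x \<in> carrier X} \<union>
      {frag_of (m, x \<oplus>\<^bsub>X\<^esub> x') - frag_of (m, x) - frag_of (m, x') | m x x'.
         m \<in> carrier M \<and> x \<in> carrier X \<and> x' \<in> carrier X} \<union>
      {frag_of (m \<odot>\<^sub>r\<^bsub>M\<^esub> r, x) - frag_of (m, r \<odot>\<^bsub>X\<^esub> x) | m r x.
         m \<in> carrier M \<and> r \<in> carrier R \<and> x \<in> carrier X})"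

definition tens ::
  "[('r, 'a) ring_scheme, ('s, 'r, 'm, 'b) bimodule_scheme, ('r, 'x, 'c) module_scheme, 'm, 'x]
    \<Rightarrow> ('m \<times> 'x \<Rightarrow>\<^sub>0 int) set"
  where "tens R M X m x =
    tensor_rel R M X #>\<^bsub>free_Abelian_group (carrier M \<times> carrier X)\<^esub> frag_of (m, x)"

text \<open>
  \<open>tensor_map R M X f g\<close> is the map \<open>f \<otimes> g\<close> with values in \<open>M \<otimes>\<^sub>R X\<close>: a coset is sent to the coset
  of the images of its members.
\<close>

definition tensor_map ::
  "[('r, 'a) ring_scheme, ('s, 'r, 'm, 'b) bimodule_scheme, ('r, 'x, 'c) module_scheme,
    'n \<Rightarrow> 'm, 'y \<Rightarrow> 'x] \<Rightarrow> ('n \<times> 'y \<Rightarrow>\<^sub>0 int) set \<Rightarrow> ('m \<times> 'x \<Rightarrow>\<^sub>0 int) set"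
  where "tensor_map R M X f g C =
    tensor_rel R M X <#>\<^bsub>free_Abelian_group (carrier M \<times> carrier X)\<^esub>
      frag_extend (\<lambda>(n, y). frag_of (f n, g y)) ` C"

definition tensor ::
  "[('r, 'a) ring_scheme, ('s, 'r, 'm, 'b) bimodule_scheme, ('r, 'x, 'c) module_scheme]
    \<Rightarrow> ('s, ('m \<times> 'x \<Rightarrow>\<^sub>0 int) set) module"
  where "tensor R M X =
    (let G = free_Abelian_group (carrier M \<times> carrier X) Mod tensor_rel R M X in
     \<lparr>carrier = carrier G, mult = undefined, one = undefined, ring.zero = \<one>\<^bsub>G\<^esub>, add = mult G,
      smult = (\<lambda>s. tensor_map R M X (\<lambda>m. s \<odot>\<^bsub>M\<^esub> m) id)\<rparr>)"

definition tensor_bimodule ::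
  "[('r, 'a) ring_scheme, ('s, 'r, 'm, 'b) bimodule_scheme, ('r, 'q, 'n, 'c) bimodule_scheme]
    \<Rightarrow> ('s, 'q, ('m \<times> 'n \<Rightarrow>\<^sub>0 int) set) bimodule"
  where "tensor_bimodule R M N =
    module.extend (tensor R M N)
      (bimodule.fields (\<lambda>C t. tensor_map R M N id (\<lambda>n. n \<odot>\<^sub>r\<^bsub>N\<^esub> t) C))"


section \<open>Theta-extensions\<close>

text \<open>
  Identities between maps on a threefold tensor product are stated on the generators
  \<open>m \<otimes> m' \<otimes> m''\<close> and \<open>m \<otimes> m' \<otimes> x\<close>.
\<close>

definition theta_associative ::
  "[('r, 'a) ring_scheme, ('r, 'r, 'm, 'b) bimodule_scheme, ('m \<times> 'm \<Rightarrow>\<^sub>0 int) set \<Rightarrow> 'm] \<Rightarrow> bool"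
  where "theta_associative R M \<theta> \<longleftrightarrow>
    (\<forall>m\<in>carrier M. \<forall>m'\<in>carrier M. \<forall>m''\<in>carrier M.
       \<theta> (tens R M M (\<theta> (tens R M M m m')) m'') = \<theta> (tens R M M m (\<theta> (tens R M M m' m''))))"

definition theta_ext ::
  "[('r, 'a) ring_scheme, ('r, 'r, 'm, 'b) bimodule_scheme, ('m \<times> 'm \<Rightarrow>\<^sub>0 int) set \<Rightarrow> 'm]
    \<Rightarrow> ('r \<times> 'm) ring"
  where "theta_ext R M \<theta> =
    \<lparr>carrier = carrier R \<times> carrier M,
     mult = (\<lambda>(r, m) (r', m').
       (r \<otimes>\<^bsub>R\<^esub> r', r \<odot>\<^bsub>M\<^esub> m' \<oplus>\<^bsub>M\<^esub> m \<odot>\<^sub>r\<^bsub>M\<^esub> r' \<oplus>\<^bsub>M\<^esub> \<theta> (tens R M M m m'))),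
     one = (\<one>\<^bsub>R\<^esub>, \<zero>\<^bsub>M\<^esub>),
     ring.zero = (\<zero>\<^bsub>R\<^esub>, \<zero>\<^bsub>M\<^esub>),
     add = (\<lambda>(r, m) (r', m'). (r \<oplus>\<^bsub>R\<^esub> r', m \<oplus>\<^bsub>M\<^esub> m'))\<rparr>"

text \<open>\<open>theta_pair R M \<theta> X \<alpha>\<close>: the pair \<open>(X, \<alpha>)\<close> is a left module over the theta-extension.\<close>

definition theta_pair ::
  "[('r, 'a) ring_scheme, ('r, 'r, 'm, 'b) bimodule_scheme, ('m \<times> 'm \<Rightarrow>\<^sub>0 int) set \<Rightarrow> 'm,
    ('r, 'x, 'c) module_scheme, ('m \<times> 'x \<Rightarrow>\<^sub>0 int) set \<Rightarrow> 'x] \<Rightarrow> bool"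
  where "theta_pair R M \<theta> X \<alpha> \<longleftrightarrow>
    left_module R X \<and> \<alpha> \<in> mod_hom R (tensor R M X) X \<and>
    (\<forall>m\<in>carrier M. \<forall>m'\<in>carrier M. \<forall>x\<in>carrier X.
       \<alpha> (tens R M X m (\<alpha> (tens R M X m' x))) = \<alpha> (tens R M X (\<theta> (tens R M M m m')) x))"

definition pair_module ::
  "[('r, 'a) ring_scheme, ('r, 'r, 'm, 'b) bimodule_scheme,
    ('r, 'x, 'c) module_scheme, ('m \<times> 'x \<Rightarrow>\<^sub>0 int) set \<Rightarrow> 'x] \<Rightarrow> ('r \<times> 'm, 'x) module"
  where "pair_module R M X \<alpha> =
    \<lparr>carrier = carrier X, mult = undefined, one = undefined, ring.zero = \<zero>\<^bsub>X\<^esub>, add = add X,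
     smult = (\<lambda>(r, m) x. r \<odot>\<^bsub>X\<^esub> x \<oplus>\<^bsub>X\<^esub> \<alpha> (tens R M X m x))\<rparr>"

definition l_bimod ::
  "[('r, 'a) ring_scheme, ('r, 'r, 'm, 'b) bimodule_scheme, ('m \<times> 'm \<Rightarrow>\<^sub>0 int) set \<Rightarrow> 'm]
    \<Rightarrow> ('r \<times> 'm, 'r, 'r \<times> 'm) bimodule"
  where "l_bimod R M \<theta> = ring_bimodule (theta_ext R M \<theta>) (\<lambda>r. (r, \<zero>\<^bsub>M\<^esub>))"

definition q_bimod :: "('r, 'a) ring_scheme \<Rightarrow> ('r, 'r \<times> 'm, 'r) bimodule"
  where "q_bimod R = ring_bimodule R fst"

text \<open>The functors \<open>l = T \<otimes>\<^sub>R -\<close> and \<open>q = R \<otimes>\<^sub>T -\<close>, the latter also on morphisms.\<close>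

definition l_fun ::
  "[('r, 'a) ring_scheme, ('r, 'r, 'm, 'b) bimodule_scheme, ('m \<times> 'm \<Rightarrow>\<^sub>0 int) set \<Rightarrow> 'm,
    ('r, 'p, 'c) module_scheme] \<Rightarrow> ('r \<times> 'm, (('r \<times> 'm) \<times> 'p \<Rightarrow>\<^sub>0 int) set) module"
  where "l_fun R M \<theta> P = tensor R (l_bimod R M \<theta>) P"

definition q_fun ::
  "[('r, 'a) ring_scheme, ('r, 'r, 'm, 'b) bimodule_scheme, ('m \<times> 'm \<Rightarrow>\<^sub>0 int) set \<Rightarrow> 'm,
    ('r \<times> 'm, 'y, 'c) module_scheme] \<Rightarrow> ('r, ('r \<times> 'y \<Rightarrow>\<^sub>0 int) set) module"
  where "q_fun R M \<theta> Y = tensor (theta_ext R M \<theta>) (q_bimod R) Y"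

definition q_map ::
  "[('r, 'a) ring_scheme, ('r, 'r, 'm, 'b) bimodule_scheme, ('m \<times> 'm \<Rightarrow>\<^sub>0 int) set \<Rightarrow> 'm,
    ('r \<times> 'm, 'y, 'c) module_scheme, 'z \<Rightarrow> 'y]
    \<Rightarrow> ('r \<times> 'z \<Rightarrow>\<^sub>0 int) set \<Rightarrow> ('r \<times> 'y \<Rightarrow>\<^sub>0 int) set"
  where "q_map R M \<theta> Y f = tensor_map (theta_ext R M \<theta>) (q_bimod R) Y id f"

text \<open>
  The canonical map \<open>y \<mapsto> 1 \<otimes> y\<close> from \<open>Y\<close> to \<open>q(Y)\<close>, and the natural isomorphism
  \<open>p \<mapsto> 1 \<otimes> (1 \<otimes> p)\<close> from \<open>P\<close> to \<open>q(l(P))\<close>.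
\<close>

definition q_unit ::
  "[('r, 'a) ring_scheme, ('r, 'r, 'm, 'b) bimodule_scheme, ('m \<times> 'm \<Rightarrow>\<^sub>0 int) set \<Rightarrow> 'm,
    ('r \<times> 'm, 'y, 'c) module_scheme, 'y] \<Rightarrow> ('r \<times> 'y \<Rightarrow>\<^sub>0 int) set"
  where "q_unit R M \<theta> Y y = tens (theta_ext R M \<theta>) (q_bimod R) Y \<one>\<^bsub>R\<^esub> y"

definition ql_iso ::
  "[('r, 'a) ring_scheme, ('r, 'r, 'm, 'b) bimodule_scheme, ('m \<times> 'm \<Rightarrow>\<^sub>0 int) set \<Rightarrow> 'm,
    ('r, 'p, 'c) module_scheme, 'p] \<Rightarrow> ('r \<times> (('r \<times> 'm) \<times> 'p \<Rightarrow>\<^sub>0 int) set \<Rightarrow>\<^sub>0 int) set"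
  where "ql_iso R M \<theta> P p =
    q_unit R M \<theta> (l_fun R M \<theta> P) (tens R (l_bimod R M \<theta>) P \<one>\<^bsub>theta_ext R M \<theta>\<^esub> p)"

text \<open>\<open>q(\<delta>)\<close> for \<open>\<delta>\<close> from \<open>l(P1)\<close> to \<open>l(P0)\<close>, regarded as a map from \<open>P1\<close> to \<open>P0\<close>.\<close>

definition q_delta ::
  "[('r, 'a) ring_scheme, ('r, 'r, 'm, 'b) bimodule_scheme, ('m \<times> 'm \<Rightarrow>\<^sub>0 int) set \<Rightarrow> 'm,
    ('r, 'y, 'c) module_scheme, ('r, 'z, 'd) module_scheme,
    (('r \<times> 'm) \<times> 'y \<Rightarrow>\<^sub>0 int) set \<Rightarrow> (('r \<times> 'm) \<times> 'z \<Rightarrow>\<^sub>0 int) set, 'y] \<Rightarrow> 'z"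
  where "q_delta R M \<theta> P1 P0 \<delta> =
    inv_into (carrier P0) (ql_iso R M \<theta> P0) \<circ> q_map R M \<theta> (l_fun R M \<theta> P0) \<delta> \<circ> ql_iso R M \<theta> P1"

text \<open>
  The isomorphism from \<open>q(X, \<alpha>)\<close> to \<open>Coker \<alpha>\<close> is the inverse of \<open>x + Im \<alpha> \<mapsto> 1 \<otimes> x\<close>: it sends
  \<open>z\<close> to the fibre of \<open>x \<mapsto> 1 \<otimes> x\<close> over \<open>z\<close>, which is a coset of \<open>Im \<alpha>\<close>.
\<close>

definition q_to_coker ::
  "[('r, 'a) ring_scheme, ('r, 'r, 'm, 'b) bimodule_scheme, ('m \<times> 'm \<Rightarrow>\<^sub>0 int) set \<Rightarrow> 'm,
    ('r, 'x, 'c) module_scheme, ('m \<times> 'x \<Rightarrow>\<^sub>0 int) set \<Rightarrow> 'x, ('r \<times> 'x \<Rightarrow>\<^sub>0 int) set] \<Rightarrow> 'x set"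
  where "q_to_coker R M \<theta> X \<alpha> z = {x \<in> carrier X. q_unit R M \<theta> (pair_module R M X \<alpha>) x = z}"

text \<open>\<open>q(\<epsilon>)\<close> for \<open>\<epsilon>\<close> from \<open>l(P0)\<close> to \<open>(X, \<alpha>)\<close>, regarded as a map from \<open>P0\<close> to \<open>Coker \<alpha>\<close>.\<close>

definition q_epsilon ::
  "[('r, 'a) ring_scheme, ('r, 'r, 'm, 'b) bimodule_scheme, ('m \<times> 'm \<Rightarrow>\<^sub>0 int) set \<Rightarrow> 'm,
    ('r, 'z, 'c) module_scheme, ('r, 'x, 'd) module_scheme, ('m \<times> 'x \<Rightarrow>\<^sub>0 int) set \<Rightarrow> 'x,
    (('r \<times> 'm) \<times> 'z \<Rightarrow>\<^sub>0 int) set \<Rightarrow> 'x, 'z] \<Rightarrow> 'x set"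
  where "q_epsilon R M \<theta> P0 X \<alpha> \<epsilon> =
    q_to_coker R M \<theta> X \<alpha> \<circ> q_map R M \<theta> (pair_module R M X \<alpha>) \<epsilon> \<circ> ql_iso R M \<theta> P0"


section \<open>Silting modules\<close>

text \<open>
  A class of modules is represented by the modules in it whose elements belong to a type \<open>'u\<close>,
  which plays the role of a universe. The predicates \<open>silting\<close> and \<open>partial_silting\<close> take \<open>'u\<close> as a
  parameter; a module is (partial) silting in the absolute sense if it is so for all \<open>'u\<close>.
\<close>

definition D_class ::
  "[('r, 'a) ring_scheme, ('r, 'y, 'b) module_scheme, 'y \<Rightarrow> 'z, ('r, 'z, 'c) module_scheme]
    \<Rightarrow> ('r, 'u) module set"
  where "D_class R X \<sigma> Z =
    {L. left_module R L \<and>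
        (\<forall>f\<in>mod_hom R X L. \<exists>g\<in>mod_hom R Z L. \<forall>x\<in>carrier X. g (\<sigma> x) = f x)}"

text \<open>
  Index sets of functions from \<open>X\<close> to \<open>L\<close> suffice for all quotients \<open>L\<close> of direct sums of copies
  of \<open>X\<close>: copies on which the epimorphism restricts to the same homomorphism can be merged.
\<close>

definition Gen ::
  "[('r, 'a) ring_scheme, ('r, 'x, 'b) module_scheme] \<Rightarrow> ('r, 'u) module set"
  where "Gen R X =
    {L. left_module R L \<and>
        (\<exists>(I :: ('x \<Rightarrow> 'u) set). \<exists>f\<in>mod_hom R (direct_sum I (\<lambda>_. X)) L.
           f ` carrier (direct_sum I (\<lambda>_. X)) = carrier L)}"

text \<open>
  Torsion classes are closed under quotients, extensions and all direct sums that exist, up to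
  isomorphism, among the modules with elements in \<open>'u\<close>. Index sets in \<open>'u\<close> suffice for the latter,
  since the nonzero summands of a module are indexed by at most as many indices as it has elements.
\<close>

definition torsion_class :: "[('r, 'a) ring_scheme, ('r, 'u) module set] \<Rightarrow> bool"
  where "torsion_class R C \<longleftrightarrow>
    C \<subseteq> {L. left_module R L} \<and>
    (\<forall>L\<in>C. \<forall>N. left_module R N \<and> (\<exists>f\<in>mod_hom R L N. f ` carrier L = carrier N) \<longrightarrow> N \<in> C) \<and>
    (\<forall>A\<in>C. \<forall>B\<in>C. \<forall>N. left_module R N \<and>
       (\<exists>f\<in>mod_hom R A N. \<exists>g\<in>mod_hom R N B.
          inj_on f (carrier A) \<and> f ` carrier A = a_kernel N B g \<and> g ` carrier N = carrier B)
       \<longrightarrow> N \<in> C) \<and>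
    (\<forall>(I :: 'u set) L N. (\<forall>i\<in>I. L i \<in> C) \<and> left_module R N \<and>
       (\<exists>f\<in>mod_hom R (direct_sum I L) N. bij_betw f (carrier (direct_sum I L)) (carrier N))
       \<longrightarrow> N \<in> C)"

definition silting ::
  "['u itself, ('r, 'a) ring_scheme, ('r, 'y, 'b) module_scheme, 'y \<Rightarrow> 'z,
    ('r, 'z, 'c) module_scheme, 'z \<Rightarrow> 'x, ('r, 'x) module] \<Rightarrow> bool"
  where "silting _ R Q1 \<sigma> Q0 \<pi> X \<longleftrightarrow>
    projective_presentation R Q1 \<sigma> Q0 \<pi> X \<and>
    (Gen R X :: ('r, 'u) module set) = D_class R Q1 \<sigma> Q0"

definition partial_silting ::
  "['u itself, ('r, 'a) ring_scheme, ('r, 'y, 'b) module_scheme, 'y \<Rightarrow> 'z,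
    ('r, 'z, 'c) module_scheme, 'z \<Rightarrow> 'x, ('r, 'x) module] \<Rightarrow> bool"
  where "partial_silting _ R Q1 \<sigma> Q0 \<pi> X \<longleftrightarrow>
    projective_presentation R Q1 \<sigma> Q0 \<pi> X \<and>
    X \<in> D_class R Q1 \<sigma> Q0 \<and>
    torsion_class R (D_class R Q1 \<sigma> Q0 :: ('r, 'u) module set)"

end

(*
  Write Z for restriction of scalars along T \<rightarrow> R. It is right adjoint to q, and q l is the
  identity, so Hom_T(l(P), Z L) = Hom_R(P, L) naturally. Hence L lies in the class D of q(\<delta>) iff
  Z L lies in the class D of \<delta>, and, since homomorphisms (X, \<alpha>) \<rightarrow> Z L are the
  homomorphisms Coker \<alpha> \<rightarrow> L, L lies in Gen(Coker \<alpha>) iff Z L lies in Gen(X, \<alpha>); this is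
  the silting case. As Z keeps underlying groups and maps, being a torsion class descends from the
  class D of \<delta> to that of q(\<delta>). Finally (X, \<alpha>) maps onto Z(Coker \<alpha>), and the class D of a
  morphism with projective domain is closed under quotients.
*)

theory Submission
  imports Defs
begin

section \<open>Tensor products\<close>

text \<open>Tensor products are concrete quotients of free abelian groups, so maps and equalities on
  them are reached only through elementary tensors. The adjunction is therefore handled on elements:
  \<open>\<eta>\<close> sends p to 1 \<otimes> p in l(P), \<open>\<kappa>\<close> sends t \<otimes>
  p to (fst t) p, \<kappa> after \<eta> is the identity, and \<eta> after \<kappa> is invisible to
  every T-linear map into a restricted module. In these terms q(\<delta>) is \<kappa> \<delta>
  \<eta>, and the square \<kappa> \<delta> = q(\<delta>) \<kappa> carries extension problems back
  and forth.

  Being (partial) silting includes a projective presentation, so the exactness of q on the given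
  presentation has to be established too; the delicate point is that elements of Im \<alpha> lift to
  the kernel of \<kappa>.

  \<open>Gen\<close> quantifies over index sets whose type depends on the module: functions on 'x
  for (X, \<alpha>), functions on sets over 'x for Coker \<alpha>. The two classes are compared
  through the trace, the subgroup generated by the images of all homomorphisms, which mentions no
  index set.\<close>

lemma abelian_group_of_comm_group:
  assumes "comm_group G" and "carrier M = carrier G" "add M = mult G" "ring.zero M = one G"
  shows "abelian_group M"
proof -
  interpret comm_group G by fact
  show ?thesis
    by (rule abelian_groupI) (use assms l_inv_ex in \<open>auto simp: m_ac\<close>)
qed

lemma abelian_group_homI:
  assumes "abelian_group A" "abelian_group B" "h \<in> hom (add_monoid A) (add_monoid B)"
  shows "abelian_group_hom A B h"
  using assms by (simp add: abelian_group_hom_def abelian_group_hom_axioms_def group_hom_def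
      group_hom_axioms_def abelian_group.a_group)

locale tensor_product = M: bimodule S R M + X: left_module R X
  for S :: "('s, 'a) ring_scheme" and R :: "('r, 'b) ring_scheme"
    and M :: "('s, 'r, 'm, 'c) bimodule_scheme" and X :: "('r, 'x, 'd) module_scheme"
begin

abbreviation F where "F \<equiv> free_Abelian_group (carrier M \<times> carrier X)"

text \<open>A subgroup contains the relations once it contains the three kinds of generators. It is
  applied to the kernel of a map (to factor it through the tensor product) and to the preimage of
  another relation subgroup (to compare two tensor products).\<close>

lemma tensor_rel_least:
  assumes K: "subgroup K F"
    and "\<And>m m' x. \<lbrakk>m \<in> carrier M; m' \<in> carrier M; x \<in> carrier X\<rbrakk> \<Longrightarrow>
      frag_of (m \<oplus>\<^bsub>M\<^esub> m', x) - frag_of (m, x) - frag_of (m', x) \<in> K"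
    and "\<And>m x x'. \<lbrakk>m \<in> carrier M; x \<in> carrier X; x' \<in> carrier X\<rbrakk> \<Longrightarrow>
      frag_of (m, x \<oplus>\<^bsub>X\<^esub> x') - frag_of (m, x) - frag_of (m, x') \<in> K"
    and "\<And>m r x. \<lbrakk>m \<in> carrier M; r \<in> carrier R; x \<in> carrier X\<rbrakk> \<Longrightarrow>
      frag_of (m \<odot>\<^sub>r\<^bsub>M\<^esub> r, x) - frag_of (m, r \<odot>\<^bsub>X\<^esub> x) \<in> K"
  shows "tensor_rel R M X \<subseteq> K"
  unfolding tensor_rel_def
  by (rule group.generate_subgroup_incl[OF group_free_Abelian_group _ K]) (use assms(2-) in auto)

lemma frag_of_in_F: "\<lbrakk>m \<in> carrier M; x \<in> carrier X\<rbrakk> \<Longrightarrow> frag_of (m, x) \<in> carrier F"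
  by simp

lemma diff_in_F: "\<lbrakk>a \<in> carrier F; b \<in> carrier F\<rbrakk> \<Longrightarrow> a - b \<in> carrier F"
  using keys_diff[of a b] by auto

lemma add_in_F: "\<lbrakk>a \<in> carrier F; b \<in> carrier F\<rbrakk> \<Longrightarrow> a + b \<in> carrier F"
  using keys_add[of a b] by auto

lemma subgroup_tensor_rel: "subgroup (tensor_rel R M X) F"
  unfolding tensor_rel_def
  by (rule group.generate_is_subgroup[OF group_free_Abelian_group])
    (auto simp del: carrier_free_Abelian_group_iff intro!: diff_in_F frag_of_in_F)

lemma normal_tensor_rel: "tensor_rel R M X \<lhd> F"
  by (rule comm_group.normal_iff_subgroup[THEN iffD2])
    (simp_all add: abelian_free_Abelian_group subgroup_tensor_rel)

lemma tensor_rel_gens: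
  shows "\<lbrakk>m \<in> carrier M; m' \<in> carrier M; x \<in> carrier X\<rbrakk> \<Longrightarrow>
      frag_of (m \<oplus>\<^bsub>M\<^esub> m', x) - frag_of (m, x) - frag_of (m', x) \<in> tensor_rel R M X"
    and "\<lbrakk>m \<in> carrier M; x \<in> carrier X; x' \<in> carrier X\<rbrakk> \<Longrightarrow>
      frag_of (m, x \<oplus>\<^bsub>X\<^esub> x') - frag_of (m, x) - frag_of (m, x') \<in> tensor_rel R M X"
    and "\<lbrakk>m \<in> carrier M; r \<in> carrier R; x \<in> carrier X\<rbrakk> \<Longrightarrow>
      frag_of (m \<odot>\<^sub>r\<^bsub>M\<^esub> r, x) - frag_of (m, r \<odot>\<^bsub>X\<^esub> x) \<in> tensor_rel R M X"
  unfolding tensor_rel_def by (rule generate.incl, blast)+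

lemma coset_hom: "(\<lambda>c. tensor_rel R M X #>\<^bsub>F\<^esub> c) \<in> hom F (add_monoid (tensor R M X))"
  using normal.r_coset_hom_Mod[OF normal_tensor_rel]
  by (simp add: hom_def tensor_def Let_def)

lemma carrier_tensor: "carrier (tensor R M X) = (\<lambda>c. tensor_rel R M X #>\<^bsub>F\<^esub> c) ` carrier F"
  by (auto simp: tensor_def Let_def FactGroup_def RCOSETS_def)

lemma abelian_group_tensor: "abelian_group (tensor R M X)"
proof (rule abelian_group_of_comm_group)
  show "comm_group (F Mod tensor_rel R M X)"
    by (simp add: comm_group.abelian_FactGroup abelian_free_Abelian_group subgroup_tensor_rel)
qed (simp_all add: tensor_def Let_def)

sublocale T: abelian_group "tensor R M X"
  by (rule abelian_group_tensor)

sublocale c: group_hom F "add_monoid (tensor R M X)" "\<lambda>c. tensor_rel R M X #>\<^bsub>F\<^esub> c"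
  by (simp add: group_hom_def group_hom_axioms_def coset_hom T.a_group)

lemma coset_minus:
  assumes "a \<in> carrier F" "b \<in> carrier F"
  shows "tensor_rel R M X #>\<^bsub>F\<^esub> (a - b) =
    (tensor_rel R M X #>\<^bsub>F\<^esub> a) \<ominus>\<^bsub>tensor R M X\<^esub> (tensor_rel R M X #>\<^bsub>F\<^esub> b)"
proof -
  have "tensor_rel R M X #>\<^bsub>F\<^esub> (- b) = \<ominus>\<^bsub>tensor R M X\<^esub> (tensor_rel R M X #>\<^bsub>F\<^esub> b)"
    using assms c.hom_inv[of b] by (simp add: a_inv_def)
  then show ?thesis
    using assms c.hom_mult[of a "- b"] by (simp add: a_minus_def)
qed

lemma coset_eqI:
  assumes "a \<in> carrier F" "b \<in> carrier F" "a - b \<in> tensor_rel R M X"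
  shows "tensor_rel R M X #>\<^bsub>F\<^esub> a = tensor_rel R M X #>\<^bsub>F\<^esub> b"
proof (rule group.repr_independence[symmetric, OF group_free_Abelian_group _ _ subgroup_tensor_rel])
  show "a \<in> tensor_rel R M X #>\<^bsub>F\<^esub> b"
    using assms by (force simp: r_coset_def)
qed (use assms in auto)

lemma tens_closed [simp, intro]:
  "\<lbrakk>m \<in> carrier M; x \<in> carrier X\<rbrakk> \<Longrightarrow> tens R M X m x \<in> carrier (tensor R M X)"
  using c.hom_closed[OF frag_of_in_F[of m x]] by (simp add: tens_def)

lemma add_coset: "\<lbrakk>a \<in> carrier F; b \<in> carrier F\<rbrakk> \<Longrightarrow>
  (tensor_rel R M X #>\<^bsub>F\<^esub> a) \<oplus>\<^bsub>tensor R M X\<^esub> (tensor_rel R M X #>\<^bsub>F\<^esub> b) = tensor_rel R M X #>\<^bsub>F\<^esub> (a + b)"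
  using c.hom_mult[of a b] by simp

lemma tens_add_left:
  assumes "m \<in> carrier M" "m' \<in> carrier M" "x \<in> carrier X"
  shows "tens R M X (m \<oplus>\<^bsub>M\<^esub> m') x = tens R M X m x \<oplus>\<^bsub>tensor R M X\<^esub> tens R M X m' x"
proof -
  have "frag_of (m, x) + frag_of (m', x) \<in> carrier F"
    using keys_add[of "frag_of (m, x)" "frag_of (m', x)"] assms by auto
  then show ?thesis
    using assms tensor_rel_gens(1)[OF assms] unfolding tens_def
    by (subst add_coset, simp, simp, intro coset_eqI) (simp_all add: diff_diff_eq)
qed

lemma tens_add_right:
  assumes "m \<in> carrier M" "x \<in> carrier X" "x' \<in> carrier X"
  shows "tens R M X m (x \<oplus>\<^bsub>X\<^esub> x') = tens R M X m x \<oplus>\<^bsub>tensor R M X\<^esub> tens R M X m x'"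
proof -
  have "frag_of (m, x) + frag_of (m, x') \<in> carrier F"
    using keys_add[of "frag_of (m, x)" "frag_of (m, x')"] assms by auto
  then show ?thesis
    using assms tensor_rel_gens(2)[OF assms] unfolding tens_def
    by (subst add_coset, simp, simp, intro coset_eqI) (simp_all add: diff_diff_eq)
qed

lemma tens_rsmult:
  assumes "m \<in> carrier M" "r \<in> carrier R" "x \<in> carrier X"
  shows "tens R M X (m \<odot>\<^sub>r\<^bsub>M\<^esub> r) x = tens R M X m (r \<odot>\<^bsub>X\<^esub> x)"
  unfolding tens_def
  by (rule coset_eqI) (use assms tensor_rel_gens(3)[OF assms] in auto)

lemma tens_zero_left:
  assumes "x \<in> carrier X"
  shows "tens R M X \<zero>\<^bsub>M\<^esub> x = \<zero>\<^bsub>tensor R M X\<^esub>"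
  using tens_add_left[of "\<zero>\<^bsub>M\<^esub>" "\<zero>\<^bsub>M\<^esub>" x] assms
  by (metis T.add.r_cancel_one' M.L.M.zero_closed M.L.M.l_zero tens_closed)

text \<open>Free abelian groups are exhausted by differences of generators, so one case for
  subtraction takes the place of sums and negatives. This is why additive maps are used below mostly
  through \<open>abelian_group_hom_minus\<close>.\<close>

lemma tensor_induct [consumes 1, case_names zero tens minus]:
  assumes "w \<in> carrier (tensor R M X)"
    and "P \<zero>\<^bsub>tensor R M X\<^esub>"
    and "\<And>m x. \<lbrakk>m \<in> carrier M; x \<in> carrier X\<rbrakk> \<Longrightarrow> P (tens R M X m x)"
    and diff: "\<And>u v. \<lbrakk>u \<in> carrier (tensor R M X); v \<in> carrier (tensor R M X); P u; P v\<rbrakk> \<Longrightarrow>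
      P (u \<ominus>\<^bsub>tensor R M X\<^esub> v)"
  shows "P w"
proof -
  obtain c where c: "c \<in> carrier F" "w = tensor_rel R M X #>\<^bsub>F\<^esub> c"
    using assms(1) carrier_tensor by auto
  have "Poly_Mapping.keys c \<subseteq> carrier M \<times> carrier X" using c by simp
  then have "c \<in> carrier F \<and> P (tensor_rel R M X #>\<^bsub>F\<^esub> c)"
  proof (induction rule: frag_induction)
    case zero
    then show ?case using c.hom_one assms(2) by simp
  next
    case (one x)
    then show ?case using assms(3)[of "fst x" "snd x"] by (auto simp: tens_def)
  next
    case (diff a b)
    then show ?case
      using assms(4)[of "tensor_rel R M X #>\<^bsub>F\<^esub> a" "tensor_rel R M X #>\<^bsub>F\<^esub> b"] c.hom_closed[of a] c.hom_closed[of b]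
      by (auto simp: coset_minus diff_in_F simp del: carrier_free_Abelian_group_iff)
  qed
  then show ?thesis using c by simp
qed

text \<open>Extend \<beta> to the free abelian group; biadditivity and balancedness say exactly that
  the three kinds of relators lie in the kernel. The result is additive only, and linearity over the
  left ring has to be checked separately.\<close>

lemma tensor_universal:
  assumes A: "abelian_group A"
    and cl: "\<And>m x. \<lbrakk>m \<in> carrier M; x \<in> carrier X\<rbrakk> \<Longrightarrow> \<beta> m x \<in> carrier A"
    and add_l: "\<And>m m' x. \<lbrakk>m \<in> carrier M; m' \<in> carrier M; x \<in> carrier X\<rbrakk> \<Longrightarrow>
      \<beta> (m \<oplus>\<^bsub>M\<^esub> m') x = \<beta> m x \<oplus>\<^bsub>A\<^esub> \<beta> m' x"
    and add_r: "\<And>m x x'. \<lbrakk>m \<in> carrier M; x \<in> carrier X; x' \<in> carrier X\<rbrakk> \<Longrightarrow>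
      \<beta> m (x \<oplus>\<^bsub>X\<^esub> x') = \<beta> m x \<oplus>\<^bsub>A\<^esub> \<beta> m x'"
    and bal: "\<And>m r x. \<lbrakk>m \<in> carrier M; r \<in> carrier R; x \<in> carrier X\<rbrakk> \<Longrightarrow>
      \<beta> (m \<odot>\<^sub>r\<^bsub>M\<^esub> r) x = \<beta> m (r \<odot>\<^bsub>X\<^esub> x)"
  shows "\<exists>h\<in>hom (add_monoid (tensor R M X)) (add_monoid A).
    \<forall>m\<in>carrier M. \<forall>x\<in>carrier X. h (tens R M X m x) = \<beta> m x"
proof -
  interpret A: abelian_group A by fact
  obtain k where k: "k \<in> hom F (add_monoid A)"
    "\<And>p. p \<in> carrier M \<times> carrier X \<Longrightarrow> k (frag_of p) = \<beta> (fst p) (snd p)"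
    using comm_group.free_Abelian_group_universal[OF A.a_comm_group, of "\<lambda>p. \<beta> (fst p) (snd p)" "carrier M \<times> carrier X"] cl
    by (auto simp: image_subset_iff)
  interpret k: group_hom F "add_monoid A" k
    using k by (simp add: group_hom_def group_hom_axioms_def A.a_group)
  have kd: "k (a - b) = k a \<ominus>\<^bsub>A\<^esub> k b" if "a \<in> carrier F" "b \<in> carrier F" for a b
    using k.hom_mult[of a "inv\<^bsub>F\<^esub> b"] k.hom_inv[of b] that
    by (simp add: a_minus_def a_inv_def)
  have kadd: "k (a + b) = k a \<oplus>\<^bsub>A\<^esub> k b" if "a \<in> carrier F" "b \<in> carrier F" for a b
    using k.hom_mult[of a b] that by simp
  have "tensor_rel R M X \<subseteq> kernel F (add_monoid A) k"
  proof (rule tensor_rel_least[OF k.subgroup_kernel])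
    fix m m' x assume *: "m \<in> carrier M" "m' \<in> carrier M" "x \<in> carrier X"
    then show "frag_of (m \<oplus>\<^bsub>M\<^esub> m', x) - frag_of (m, x) - frag_of (m', x) \<in> kernel F (add_monoid A) k"
      using cl by (simp add: kernel_def kd kadd diff_diff_eq diff_in_F add_in_F frag_of_in_F k add_l
          A.minus_eq A.r_neg del: carrier_free_Abelian_group_iff)
  next
    fix m x x' assume *: "m \<in> carrier M" "x \<in> carrier X" "x' \<in> carrier X"
    then show "frag_of (m, x \<oplus>\<^bsub>X\<^esub> x') - frag_of (m, x) - frag_of (m, x') \<in> kernel F (add_monoid A) k"
      using cl by (simp add: kernel_def kd kadd diff_diff_eq diff_in_F add_in_F frag_of_in_F k add_r
          A.minus_eq A.r_neg del: carrier_free_Abelian_group_iff)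
  next
    fix m r x assume *: "m \<in> carrier M" "r \<in> carrier R" "x \<in> carrier X"
    then show "frag_of (m \<odot>\<^sub>r\<^bsub>M\<^esub> r, x) - frag_of (m, r \<odot>\<^bsub>X\<^esub> x) \<in> kernel F (add_monoid A) k"
      using cl by (simp add: kernel_def kd diff_in_F frag_of_in_F k bal A.minus_eq A.r_neg
          del: carrier_free_Abelian_group_iff)
  qed
  then obtain h where h: "h \<in> hom (F Mod tensor_rel R M X) (add_monoid A)"
    "\<And>x. x \<in> carrier F \<Longrightarrow> h (tensor_rel R M X #>\<^bsub>F\<^esub> x) = k x"
    using k.FactGroup_universal_kernel[OF normal_tensor_rel] by blast
  show ?thesis
  proof (intro bexI ballI)
    show "h \<in> hom (add_monoid (tensor R M X)) (add_monoid A)"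
      using h(1) by (simp add: tensor_def Let_def hom_def)
    show "h (tens R M X m x) = \<beta> m x" if "m \<in> carrier M" "x \<in> carrier X" for m x
      using that h(2)[OF frag_of_in_F] k(2) by (simp add: tens_def)
  qed
qed

end

text \<open>\<open>tensor_map\<close> acts on cosets as sets. The map \<phi> of free groups sends
  relations to relations, so the image of a coset stays inside one coset, and adding the relation
  subgroup of the target fills that coset up.\<close>

lemma tensor_map_tens:
  assumes "tensor_product S R M X" and "tensor_product S' R N Y"
    and f: "\<And>n. n \<in> carrier N \<Longrightarrow> f n \<in> carrier M"
    and f_add: "\<And>n n'. \<lbrakk>n \<in> carrier N; n' \<in> carrier N\<rbrakk> \<Longrightarrow> f (n \<oplus>\<^bsub>N\<^esub> n') = f n \<oplus>\<^bsub>M\<^esub> f n'"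
    and f_rsmult: "\<And>n r. \<lbrakk>n \<in> carrier N; r \<in> carrier R\<rbrakk> \<Longrightarrow> f (n \<odot>\<^sub>r\<^bsub>N\<^esub> r) = f n \<odot>\<^sub>r\<^bsub>M\<^esub> r"
    and g: "g \<in> mod_hom R Y X"
    and n: "n \<in> carrier N" and y: "y \<in> carrier Y"
  shows "tensor_map R M X f g (tens R N Y n y) = tens R M X (f n) (g y)"
proof -
  interpret A: tensor_product S R M X by fact
  interpret B: tensor_product S' R N Y by fact
  let ?\<phi> = "frag_extend (\<lambda>(n, y). frag_of (f n, g y))"
  have gc: "g y \<in> carrier X" if "y \<in> carrier Y" for y
    using g that by (auto simp: mod_hom_def hom_def)
  have ga: "g (y \<oplus>\<^bsub>Y\<^esub> y') = g y \<oplus>\<^bsub>X\<^esub> g y'" if "y \<in> carrier Y" "y' \<in> carrier Y" for y y'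
    using g that by (auto simp: mod_hom_def hom_def)
  have gs: "g (r \<odot>\<^bsub>Y\<^esub> y) = r \<odot>\<^bsub>X\<^esub> g y" if "r \<in> carrier R" "y \<in> carrier Y" for y r
    using g that by (auto simp: mod_hom_def)
  interpret rel: subgroup "tensor_rel R M X" A.F by (rule A.subgroup_tensor_rel)
  have rel_diff: "a - b \<in> tensor_rel R M X" if "a \<in> tensor_rel R M X" "b \<in> tensor_rel R M X" for a b
    using rel.m_closed[OF that(1) rel.m_inv_closed[OF that(2)]] rel.mem_carrier[OF that(2)] by simp
  \<comment> \<open>The preimage of the target relations under \<phi>; it contains the source
    relations once it contains their generators.\<close>
  have sub: "subgroup {c \<in> carrier B.F. ?\<phi> c \<in> tensor_rel R M X} B.F"
  proof (rule group.subgroupI)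
    show "inv\<^bsub>B.F\<^esub> a \<in> {c \<in> carrier B.F. ?\<phi> c \<in> tensor_rel R M X}"
      if "a \<in> {c \<in> carrier B.F. ?\<phi> c \<in> tensor_rel R M X}" for a
      using that rel_diff[OF rel.one_closed, of "?\<phi> a"] by (auto simp: frag_extend_minus)
    show "a \<otimes>\<^bsub>B.F\<^esub> b \<in> {c \<in> carrier B.F. ?\<phi> c \<in> tensor_rel R M X}"
      if "a \<in> {c \<in> carrier B.F. ?\<phi> c \<in> tensor_rel R M X}" "b \<in> {c \<in> carrier B.F. ?\<phi> c \<in> tensor_rel R M X}" for a b
      using that rel.m_closed[of "?\<phi> a" "?\<phi> b"] keys_add[of a b] by (auto simp: frag_extend_add)
  qed (use rel.one_closed in \<open>auto intro!: exI[of _ 0]\<close>)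
  have "tensor_rel R N Y \<subseteq> {c \<in> carrier B.F. ?\<phi> c \<in> tensor_rel R M X}"
    by (rule B.tensor_rel_least[OF sub])
      (simp_all add: B.diff_in_F B.frag_of_in_F frag_extend_diff f f_add f_rsmult gc ga gs
        A.tensor_rel_gens del: carrier_free_Abelian_group_iff)
  then have img: "?\<phi> ` tensor_rel R N Y \<subseteq> tensor_rel R M X" by auto
  have "0 \<in> tensor_rel R N Y" using subgroup.one_closed[OF B.subgroup_tensor_rel] by simp
  then have img0: "0 \<in> ?\<phi> ` tensor_rel R N Y" by (metis frag_extend_0 imageI)
  have "?\<phi> ` tens R N Y n y = (\<lambda>c. c + frag_of (f n, g y)) ` ?\<phi> ` tensor_rel R N Y"
    by (force simp: tens_def r_coset_def frag_extend_add)
  \<comment> \<open>Applied with K the image of the source relations. Membership of 0 in K keeps the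
    set product from missing part of the coset.\<close>
  moreover have "tensor_rel R M X <#>\<^bsub>A.F\<^esub> (\<lambda>c. c + d) ` K = tensor_rel R M X #>\<^bsub>A.F\<^esub> d"
    if "K \<subseteq> tensor_rel R M X" "0 \<in> K" for K d
  proof -
    have "h + k + d \<in> tensor_rel R M X #>\<^bsub>A.F\<^esub> d" if "h \<in> tensor_rel R M X" "k \<in> K" for h k
      using that rel.m_closed[of h k] \<open>K \<subseteq> tensor_rel R M X\<close> by (force simp: r_coset_def)
    then have "tensor_rel R M X <#>\<^bsub>A.F\<^esub> (\<lambda>c. c + d) ` K \<subseteq> tensor_rel R M X #>\<^bsub>A.F\<^esub> d"
      by (auto simp: set_mult_def add.assoc[symmetric])
    moreover have "h + d \<in> tensor_rel R M X <#>\<^bsub>A.F\<^esub> (\<lambda>c. c + d) ` K" if "h \<in> tensor_rel R M X" for h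
      using that image_eqI[of d "\<lambda>c. c + d" 0, OF _ \<open>0 \<in> K\<close>] by (force simp: set_mult_def)
    then have "tensor_rel R M X #>\<^bsub>A.F\<^esub> d \<subseteq> tensor_rel R M X <#>\<^bsub>A.F\<^esub> (\<lambda>c. c + d) ` K"
      by (auto simp: r_coset_def)
    ultimately show ?thesis by blast
  qed
  ultimately show ?thesis
    using img img0 by (simp add: tensor_map_def tens_def)
qed

section \<open>Homomorphisms, direct sums and quotients\<close>

lemma mod_homI:
  assumes "\<And>x. x \<in> carrier X \<Longrightarrow> f x \<in> carrier Y"
    and "\<And>x x'. \<lbrakk>x \<in> carrier X; x' \<in> carrier X\<rbrakk> \<Longrightarrow> f (x \<oplus>\<^bsub>X\<^esub> x') = f x \<oplus>\<^bsub>Y\<^esub> f x'"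
    and "\<And>r x. \<lbrakk>r \<in> carrier R; x \<in> carrier X\<rbrakk> \<Longrightarrow> f (r \<odot>\<^bsub>X\<^esub> x) = r \<odot>\<^bsub>Y\<^esub> f x"
  shows "f \<in> mod_hom R X Y"
  using assms by (auto simp: mod_hom_def hom_def)

lemma mod_hom_closed: "\<lbrakk>f \<in> mod_hom R X Y; x \<in> carrier X\<rbrakk> \<Longrightarrow> f x \<in> carrier Y"
  by (auto simp: mod_hom_def hom_def)

lemma mod_hom_add:
  "\<lbrakk>f \<in> mod_hom R X Y; x \<in> carrier X; x' \<in> carrier X\<rbrakk> \<Longrightarrow> f (x \<oplus>\<^bsub>X\<^esub> x') = f x \<oplus>\<^bsub>Y\<^esub> f x'"
  by (auto simp: mod_hom_def hom_def)

lemma mod_hom_smult: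
  "\<lbrakk>f \<in> mod_hom R X Y; r \<in> carrier R; x \<in> carrier X\<rbrakk> \<Longrightarrow> f (r \<odot>\<^bsub>X\<^esub> x) = r \<odot>\<^bsub>Y\<^esub> f x"
  by (auto simp: mod_hom_def)

lemma mod_hom_compose:
  "\<lbrakk>f \<in> mod_hom R X Y; g \<in> mod_hom R Y Z\<rbrakk> \<Longrightarrow> (\<lambda>x. g (f x)) \<in> mod_hom R X Z"
  by (auto intro!: mod_homI simp: mod_hom_closed mod_hom_add mod_hom_smult)

lemma mod_hom_additive:
  "\<lbrakk>f \<in> mod_hom R X Y; abelian_group X; abelian_group Y\<rbrakk> \<Longrightarrow> abelian_group_hom X Y f"
  by (rule abelian_group_homI) (auto simp: mod_hom_def)

lemma abelian_group_hom_minus: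
  assumes "abelian_group_hom A B f" "x \<in> carrier A" "y \<in> carrier A"
  shows "f (x \<ominus>\<^bsub>A\<^esub> y) = f x \<ominus>\<^bsub>B\<^esub> f y"
proof -
  interpret abelian_group_hom A B f by fact
  show ?thesis using assms by (simp add: a_minus_def)
qed

lemma (in left_module) smult_zero_left: "x \<in> carrier M \<Longrightarrow> \<zero> \<odot>\<^bsub>M\<^esub> x = \<zero>\<^bsub>M\<^esub>"
  using smult_l_distr[of \<zero> \<zero> x] by (metis M.add.r_cancel_one' R.l_zero R.zero_closed smult_closed)

lemma (in left_module) smult_zero_right: "r \<in> carrier R \<Longrightarrow> r \<odot>\<^bsub>M\<^esub> \<zero>\<^bsub>M\<^esub> = \<zero>\<^bsub>M\<^esub>"
  using smult_r_distr[of r "\<zero>\<^bsub>M\<^esub>" "\<zero>\<^bsub>M\<^esub>"] by (metis M.add.r_cancel_one' M.l_zero M.zero_closed smult_closed)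

lemma (in left_module) smult_finsum:
  assumes "finite I" "r \<in> carrier R" "f \<in> I \<rightarrow> carrier M"
  shows "r \<odot>\<^bsub>M\<^esub> finsum M f I = finsum M (\<lambda>i. r \<odot>\<^bsub>M\<^esub> f i) I"
  using assms
proof (induction I)
  case empty
  then show ?case by (simp add: smult_zero_right)
next
  case (insert i I)
  then have "(\<lambda>i. r \<odot>\<^bsub>M\<^esub> f i) \<in> I \<rightarrow> carrier M" "f \<in> I \<rightarrow> carrier M" by auto
  with insert show ?case by (simp add: smult_r_distr)
qed

section \<open>Direct sums: induction over finite supports and the universal property\<close>

definition ds_single :: "['i set, 'i \<Rightarrow> ('r, 'x, 'a) module_scheme, 'i, 'x] \<Rightarrow> 'i \<Rightarrow> 'x"
  where "ds_single I L i a = (\<lambda>j\<in>I. if j = i then a else \<zero>\<^bsub>L j\<^esub>)"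

locale module_family =
  fixes R :: "('r, 'a) ring_scheme" and I :: "'i set" and L :: "'i \<Rightarrow> ('r, 'x, 'b) module_scheme"
  assumes left_module: "i \<in> I \<Longrightarrow> left_module R (L i)"
begin

lemma abelian_group: "i \<in> I \<Longrightarrow> abelian_group (L i)"
  using left_module left_module.axioms(2) by blast

lemma zero_in: "i \<in> I \<Longrightarrow> \<zero>\<^bsub>L i\<^esub> \<in> carrier (L i)"
  by (simp add: abelian_group abelian_group.axioms(1) abelian_monoid.zero_closed)

lemma l_zero: "\<lbrakk>i \<in> I; a \<in> carrier (L i)\<rbrakk> \<Longrightarrow> \<zero>\<^bsub>L i\<^esub> \<oplus>\<^bsub>L i\<^esub> a = a"
  by (simp add: abelian_group abelian_group.axioms(1) abelian_monoid.l_zero)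

lemma r_zero: "\<lbrakk>i \<in> I; a \<in> carrier (L i)\<rbrakk> \<Longrightarrow> a \<oplus>\<^bsub>L i\<^esub> \<zero>\<^bsub>L i\<^esub> = a"
  by (simp add: abelian_group abelian_group.axioms(1) abelian_monoid.r_zero)

lemma carrier_direct_sum:
  "carrier (direct_sum I L) =
    {x \<in> \<Pi>\<^sub>E i\<in>I. carrier (L i). finite {i \<in> I. x i \<noteq> \<zero>\<^bsub>L i\<^esub>}}"
  by (simp add: direct_sum_def Let_def carrier_sum_group abelian_group abelian_group.a_group)

lemma add_direct_sum: "x \<oplus>\<^bsub>direct_sum I L\<^esub> y = (\<lambda>i\<in>I. x i \<oplus>\<^bsub>L i\<^esub> y i)"
  by (simp add: direct_sum_def Let_def)

lemma zero_direct_sum: "\<zero>\<^bsub>direct_sum I L\<^esub> = (\<lambda>i\<in>I. \<zero>\<^bsub>L i\<^esub>)"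
  by (simp add: direct_sum_def Let_def)

lemma smult_direct_sum: "r \<odot>\<^bsub>direct_sum I L\<^esub> x = (\<lambda>i\<in>I. r \<odot>\<^bsub>L i\<^esub> x i)"
  by (simp add: direct_sum_def Let_def)

lemma direct_sum_add_closed:
  assumes "x \<in> carrier (direct_sum I L)" "y \<in> carrier (direct_sum I L)"
  shows "x \<oplus>\<^bsub>direct_sum I L\<^esub> y \<in> carrier (direct_sum I L)"
proof -
  interpret group "sum_group I (\<lambda>i. add_monoid (L i))"
    by (simp add: abelian_group abelian_group.a_group)
  show ?thesis
    using m_closed[of x y] assms by (simp add: direct_sum_def Let_def)
qed

lemma direct_sum_zero_closed: "\<zero>\<^bsub>direct_sum I L\<^esub> \<in> carrier (direct_sum I L)"
  by (simp add: carrier_direct_sum zero_direct_sum zero_in)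

lemma ds_single_closed:
  assumes "i \<in> I" "a \<in> carrier (L i)"
  shows "ds_single I L i a \<in> carrier (direct_sum I L)"
proof -
  have "{j \<in> I. ds_single I L i a j \<noteq> \<zero>\<^bsub>L j\<^esub>} \<subseteq> {i}" by (auto simp: ds_single_def)
  then have "finite {j \<in> I. ds_single I L i a j \<noteq> \<zero>\<^bsub>L j\<^esub>}" by (rule finite_subset) simp
  then show ?thesis
    using assms by (auto simp: carrier_direct_sum ds_single_def zero_in)
qed

lemma ds_single_hom:
  assumes "i \<in> I"
  shows "ds_single I L i \<in> mod_hom R (L i) (direct_sum I L)"
proof (rule mod_homI)
  show "ds_single I L i (r \<odot>\<^bsub>L i\<^esub> x) = r \<odot>\<^bsub>direct_sum I L\<^esub> ds_single I L i x"
    if "r \<in> carrier R" "x \<in> carrier (L i)" for r x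
    using that left_module.smult_zero_right[OF left_module]
    by (auto simp: ds_single_def smult_direct_sum fun_eq_iff)
  show "ds_single I L i (x \<oplus>\<^bsub>L i\<^esub> y) = ds_single I L i x \<oplus>\<^bsub>direct_sum I L\<^esub> ds_single I L i y" for x y
    by (auto simp: ds_single_def add_direct_sum fun_eq_iff l_zero zero_in)
qed (use assms ds_single_closed in auto)

text \<open>Each element has finite support, so it is a finite sum of elements concentrated at one
  index; indices are split off one at a time.\<close>

lemma direct_sum_induct [consumes 1, case_names zero single add]:
  assumes "x \<in> carrier (direct_sum I L)"
    and zero: "P \<zero>\<^bsub>direct_sum I L\<^esub>"
    and single: "\<And>i a. \<lbrakk>i \<in> I; a \<in> carrier (L i)\<rbrakk> \<Longrightarrow> P (ds_single I L i a)"
    and add: "\<And>u v. \<lbrakk>u \<in> carrier (direct_sum I L); v \<in> carrier (direct_sum I L); P u; P v\<rbrakk> \<Longrightarrow>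
      P (u \<oplus>\<^bsub>direct_sum I L\<^esub> v)"
  shows "P x"
proof -
  \<comment> \<open>S is any finite set containing the support, not the support itself: after a
    coordinate is erased only an inclusion has to be checked.\<close>
  have "P x" if "finite S" "x \<in> carrier (direct_sum I L)" "{i \<in> I. x i \<noteq> \<zero>\<^bsub>L i\<^esub>} \<subseteq> S" for S x
    using that
  proof (induction S arbitrary: x)
    case empty
    then have "x = \<zero>\<^bsub>direct_sum I L\<^esub>"
      by (auto simp: carrier_direct_sum zero_direct_sum PiE_iff extensional_def)
    then show ?case using zero by simp
  next
    case (insert i S)
    show ?case
    proof (cases "i \<in> I")
      case True
      \<comment> \<open>The element x with its coordinate at i erased.\<close>
      define y where "y = (\<lambda>j\<in>I. if j = i then \<zero>\<^bsub>L j\<^esub> else x j)"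
      have fin: "finite {j \<in> I. y j \<noteq> \<zero>\<^bsub>L j\<^esub>}"
        by (rule finite_subset[of _ S]) (use insert in \<open>auto simp: y_def\<close>)
      then have y: "y \<in> carrier (direct_sum I L)"
        using insert.prems(1) by (auto simp: y_def carrier_direct_sum zero_in)
      have xi: "x i \<in> carrier (L i)"
        using insert.prems(1) True by (auto simp: carrier_direct_sum)
      have "P y" by (rule insert.IH[OF y]) (use insert.prems in \<open>auto simp: y_def\<close>)
      moreover have "x = ds_single I L i (x i) \<oplus>\<^bsub>direct_sum I L\<^esub> y"
        using insert.prems(1)
        by (auto simp: y_def ds_single_def add_direct_sum fun_eq_iff carrier_direct_sum PiE_iff
            extensional_def l_zero r_zero)
      ultimately show ?thesis
        using add[OF ds_single_closed[OF True xi] y single[OF True xi]] by simp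
    next
      case False
      then show ?thesis using insert by blast
    qed
  qed
  then show ?thesis using assms(1) by (auto simp: carrier_direct_sum)
qed

text \<open>The map adds up the values \<open>h i (x i)\<close> over the support of x. Supports
  change under addition and scalars, so the sum must be computable over larger index sets as
  well.\<close>

lemma direct_sum_universal:
  assumes N: "left_module R N"
    and h: "\<And>i. i \<in> I \<Longrightarrow> h i \<in> mod_hom R (L i) N"
  obtains f where "f \<in> mod_hom R (direct_sum I L) N"
    and "\<And>i a. \<lbrakk>i \<in> I; a \<in> carrier (L i)\<rbrakk> \<Longrightarrow> f (ds_single I L i a) = h i a"
proof -
  interpret N: left_module R N by fact
  have h0: "h i \<zero>\<^bsub>L i\<^esub> = \<zero>\<^bsub>N\<^esub>" if "i \<in> I" for i
  proof -
    interpret abelian_group_hom "L i" N "h i"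
      using mod_hom_additive[OF h] abelian_group that N.M.abelian_group_axioms by blast
    show ?thesis by (rule hom_zero)
  qed
  define f where "f x = finsum N (\<lambda>i. h i (x i)) {i \<in> I. x i \<noteq> \<zero>\<^bsub>L i\<^esub>}" for x
  have hc: "(\<lambda>i. h i (x i)) \<in> S \<rightarrow> carrier N"
    if "S \<subseteq> I" "\<And>i. i \<in> I \<Longrightarrow> x i \<in> carrier (L i)" for S x
    using that mod_hom_closed[OF h] by blast
  \<comment> \<open>Indices outside the support contribute \<open>h i\<close> of zero, that is
    zero.\<close>
  have f: "f x = finsum N (\<lambda>i. h i (x i)) S"
    if "finite S" "S \<subseteq> I" "{i \<in> I. x i \<noteq> \<zero>\<^bsub>L i\<^esub>} \<subseteq> S" "\<And>i. i \<in> I \<Longrightarrow> x i \<in> carrier (L i)" for x S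
    unfolding f_def
    by (rule N.M.add.finprod_mono_neutral_cong_left[OF that(1,3)])
      (use that h0 hc in auto)
  show thesis
  proof
    show "f \<in> mod_hom R (direct_sum I L) N"
    proof (rule mod_homI)
      fix x assume x: "x \<in> carrier (direct_sum I L)"
      then show "f x \<in> carrier N"
        unfolding f_def by (intro N.M.finsum_closed hc) (auto simp: carrier_direct_sum)
    next
      fix x y assume x: "x \<in> carrier (direct_sum I L)" and y: "y \<in> carrier (direct_sum I L)"
      \<comment> \<open>A common finite index set for x, y and their sum.\<close>
      define S where "S = {i \<in> I. x i \<noteq> \<zero>\<^bsub>L i\<^esub>} \<union> {i \<in> I. y i \<noteq> \<zero>\<^bsub>L i\<^esub>}"
      have S: "finite S" "S \<subseteq> I" using x y by (auto simp: S_def carrier_direct_sum)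
      have xc: "i \<in> I \<Longrightarrow> x i \<in> carrier (L i)" and yc: "i \<in> I \<Longrightarrow> y i \<in> carrier (L i)" for i
        using x y by (auto simp: carrier_direct_sum)
      have xyc: "i \<in> I \<Longrightarrow> (x \<oplus>\<^bsub>direct_sum I L\<^esub> y) i \<in> carrier (L i)" for i
        using direct_sum_add_closed[OF x y] by (auto simp: carrier_direct_sum)
      have "f (x \<oplus>\<^bsub>direct_sum I L\<^esub> y) = finsum N (\<lambda>i. h i ((x \<oplus>\<^bsub>direct_sum I L\<^esub> y) i)) S"
        by (rule f[OF S _ xyc]) (auto simp: S_def add_direct_sum l_zero zero_in)
      also have "\<dots> = finsum N (\<lambda>i. h i (x i) \<oplus>\<^bsub>N\<^esub> h i (y i)) S"
        by (rule N.M.finsum_cong')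
          (use S xc yc mod_hom_closed[OF h] mod_hom_add[OF h] in \<open>auto simp: add_direct_sum subset_iff\<close>)
      also have "\<dots> = finsum N (\<lambda>i. h i (x i)) S \<oplus>\<^bsub>N\<^esub> finsum N (\<lambda>i. h i (y i)) S"
        by (rule N.M.finsum_addf) (use hc S xc yc in auto)
      also have "\<dots> = f x \<oplus>\<^bsub>N\<^esub> f y"
        using f[OF S _ xc] f[OF S _ yc] by (simp add: S_def)
      finally show "f (x \<oplus>\<^bsub>direct_sum I L\<^esub> y) = f x \<oplus>\<^bsub>N\<^esub> f y" .
    next
      fix r x assume r: "r \<in> carrier R" and x: "x \<in> carrier (direct_sum I L)"
      define S where "S = {i \<in> I. x i \<noteq> \<zero>\<^bsub>L i\<^esub>}"
      have S: "finite S" "S \<subseteq> I" using x by (auto simp: S_def carrier_direct_sum)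
      have xc: "i \<in> I \<Longrightarrow> x i \<in> carrier (L i)" for i
        using x by (auto simp: carrier_direct_sum)
      have rxc: "i \<in> I \<Longrightarrow> (r \<odot>\<^bsub>direct_sum I L\<^esub> x) i \<in> carrier (L i)" for i
        using left_module.smult_closed[OF left_module] r xc by (simp add: smult_direct_sum)
      have "f (r \<odot>\<^bsub>direct_sum I L\<^esub> x) = finsum N (\<lambda>i. h i ((r \<odot>\<^bsub>direct_sum I L\<^esub> x) i)) S"
        by (rule f[OF S _ rxc])
          (use r in \<open>auto simp: S_def smult_direct_sum left_module.smult_zero_right[OF left_module]\<close>)
      also have "\<dots> = finsum N (\<lambda>i. r \<odot>\<^bsub>N\<^esub> h i (x i)) S"
        by (rule N.M.finsum_cong')
          (use S xc r mod_hom_closed[OF h] mod_hom_smult[OF h] in \<open>auto simp: smult_direct_sum subset_iff\<close>)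
      also have "\<dots> = r \<odot>\<^bsub>N\<^esub> finsum N (\<lambda>i. h i (x i)) S"
        by (rule N.smult_finsum[symmetric]) (use S r hc xc in auto)
      also have "\<dots> = r \<odot>\<^bsub>N\<^esub> f x" using f[OF S _ xc] by (simp add: S_def)
      finally show "f (r \<odot>\<^bsub>direct_sum I L\<^esub> x) = r \<odot>\<^bsub>N\<^esub> f x" .
    qed
    fix i a assume i: "i \<in> I" and a: "a \<in> carrier (L i)"
    have "f (ds_single I L i a) = finsum N (\<lambda>j. h j (ds_single I L i a j)) {i}"
      by (rule f) (use i a in \<open>auto simp: ds_single_def zero_in\<close>)
    then show "f (ds_single I L i a) = h i a"
      using i a mod_hom_closed[OF h] by (simp add: ds_single_def)
  qed
qed

end

section \<open>Modules generated by a given module\<close>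

lemma module_familyI: "left_module R X \<Longrightarrow> module_family R I (\<lambda>_. X)"
  by (rule module_family.intro)

text \<open>The trace criterion. An epimorphism from a direct sum of copies of X is built from its
  restrictions to the copies; conversely the sum of all homomorphisms from X to L has the whole
  trace as its image. Generation as a group is enough, since the union of the images is stable under
  scalars.\<close>

lemma Gen_iff:
  fixes R :: "('r, 'a) ring_scheme" and X :: "('r, 'x, 'b) module_scheme" and L :: "('r, 'u) module"
  assumes X: "left_module R X"
  shows "L \<in> Gen R X \<longleftrightarrow> left_module R L \<and>
    carrier L \<subseteq> generate (add_monoid L) (\<Union>h\<in>mod_hom R X L. h ` carrier X)"
    (is "_ \<longleftrightarrow> _ \<and> _ \<subseteq> generate _ ?G")
proof (intro iffI conjI)
  assume "L \<in> Gen R X"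
  then obtain I :: "('x \<Rightarrow> 'u) set" and f where L: "left_module R L"
    and f: "f \<in> mod_hom R (direct_sum I (\<lambda>_. X)) L"
    and surj: "f ` carrier (direct_sum I (\<lambda>_. X)) = carrier L"
    by (auto simp: Gen_def)
  show "left_module R L" by fact
  interpret L: left_module R L by fact
  interpret D: module_family R I "\<lambda>_. X" by (rule module_familyI) fact
  have "f x \<in> generate (add_monoid L) ?G" if "x \<in> carrier (direct_sum I (\<lambda>_. X))" for x
    using that
  proof (induction rule: D.direct_sum_induct)
    \<comment> \<open>The image of zero is its own double, hence zero; this needs additivity of f
      only and no group structure on the direct sum.\<close>
    case zero
    have "f \<zero>\<^bsub>direct_sum I (\<lambda>_. X)\<^esub> \<oplus>\<^bsub>L\<^esub> f \<zero>\<^bsub>direct_sum I (\<lambda>_. X)\<^esub> = f \<zero>\<^bsub>direct_sum I (\<lambda>_. X)\<^esub>"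
      using mod_hom_add[OF f D.direct_sum_zero_closed D.direct_sum_zero_closed]
      by (simp add: D.add_direct_sum D.zero_direct_sum D.l_zero D.zero_in cong: restrict_cong)
    then have "f \<zero>\<^bsub>direct_sum I (\<lambda>_. X)\<^esub> = \<zero>\<^bsub>L\<^esub>"
      using mod_hom_closed[OF f D.direct_sum_zero_closed] by simp
    then show ?case using generate.one[of "add_monoid L"] by simp
  next
    case (single i a)
    show ?case
      by (rule generate.incl) (use single mod_hom_compose[OF D.ds_single_hom f] in blast)
  next
    case (add u v)
    then show ?case
      using generate.eng[of "f u" "add_monoid L"] mod_hom_add[OF f] by simp
  qed
  then show "carrier L \<subseteq> generate (add_monoid L) ?G"
    unfolding surj[symmetric] by blast
next
  assume *: "left_module R L \<and> carrier L \<subseteq> generate (add_monoid L) ?G"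
  then interpret L: left_module R L by simp
  interpret X: left_module R X by fact
  define I where "I = mod_hom R X L"
  interpret D: module_family R I "\<lambda>_. X" by (rule module_familyI) fact
  \<comment> \<open>One copy of X for each homomorphism to L, mapped by the index itself; the index
    type in \<open>Gen\<close> is just the one that admits this.\<close>
  obtain f where f: "f \<in> mod_hom R (direct_sum I (\<lambda>_. X)) L"
    and fs: "\<And>i a. \<lbrakk>i \<in> I; a \<in> carrier X\<rbrakk> \<Longrightarrow> f (ds_single I (\<lambda>_. X) i a) = i a"
    using D.direct_sum_universal[OF conjunct1[OF *], of "\<lambda>h. h"] by (auto simp: I_def)
  have fx: "i a \<in> f ` carrier (direct_sum I (\<lambda>_. X))" if "i \<in> I" "a \<in> carrier X" for i a
    using fs[OF that] D.ds_single_closed[OF that] by (metis imageI)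
  have "y \<in> f ` carrier (direct_sum I (\<lambda>_. X))" if "y \<in> generate (add_monoid L) ?G" for y
    using that
  proof (induction rule: generate.induct)
    case one
    \<comment> \<open>The zero homomorphism is one of the indices, so the neutral element is a value
      of f.\<close>
    have "(\<lambda>_. \<zero>\<^bsub>L\<^esub>) \<in> I" by (auto simp: I_def L.smult_zero_right intro!: mod_homI)
    then show ?case using fx[of "\<lambda>_. \<zero>\<^bsub>L\<^esub>" "\<zero>\<^bsub>X\<^esub>"] by simp
  next
    case (incl y)
    then show ?case using fx by (auto simp: I_def)
  next
    case (inv y)
    then obtain h x where h: "h \<in> I" "x \<in> carrier X" "y = h x" by (auto simp: I_def)
    then interpret abelian_group_hom X L h
      using mod_hom_additive X.M.abelian_group_axioms L.M.abelian_group_axioms by (auto simp: I_def)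
    show ?case using fx[of h "\<ominus>\<^bsub>X\<^esub> x"] h by (simp add: a_inv_def[symmetric])
  next
    case (eng u v)
    then obtain x y where "x \<in> carrier (direct_sum I (\<lambda>_. X))" "y \<in> carrier (direct_sum I (\<lambda>_. X))"
      "u = f x" "v = f y" by auto
    then show ?case
      using mod_hom_add[OF f, of x y] D.direct_sum_add_closed[of x y] by (simp add: rev_image_eqI)
  qed
  then have "f ` carrier (direct_sum I (\<lambda>_. X)) = carrier L"
    using * mod_hom_closed[OF f] by blast
  then show "L \<in> Gen R X" using f * by (auto simp: Gen_def)
qed

section \<open>Projective modules and the class D of a morphism\<close>

lemma left_module_self: "ring R \<Longrightarrow> left_module R (ring_bimodule R id)"
proof -
  assume "ring R"
  then interpret ring R .
  interpret M: abelian_group "ring_bimodule R id"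
    by (rule abelian_group_of_comm_group[OF a_comm_group]) (simp_all add: ring_bimodule_def)
  show ?thesis
    by unfold_locales (simp_all add: ring_bimodule_def l_distr r_distr m_assoc)
qed

text \<open>Choose preimages under e of the images of the free generators, extend linearly to the
  free module by its universal property, and restrict along the splitting i.\<close>

lemma projective_lift:
  fixes S :: "('s, 'a) ring_scheme" and Q :: "('s, 'q, 'b) module_scheme"
  assumes Q: "projective S Q" and A: "left_module S A" and N: "left_module S N"
    and e: "e \<in> mod_hom S A N" "e ` carrier A = carrier N" and f: "f \<in> mod_hom S Q N"
  obtains g where "g \<in> mod_hom S Q A" "\<And>x. x \<in> carrier Q \<Longrightarrow> e (g x) = f x"
proof -
  interpret Q: left_module S Q using Q by (simp add: projective_def)
  interpret A: left_module S A by fact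
  interpret N: left_module S N by fact
  interpret S: left_module S "ring_bimodule S id"
    using left_module_self Q.R.ring_axioms .
  have cS [simp]: "carrier (ring_bimodule S id) = carrier S"
    and aS [simp]: "add (ring_bimodule S id) = add S"
    and sS [simp]: "smult (ring_bimodule S id) = mult S" by (simp_all add: ring_bimodule_def)
  obtain I :: "'q set" and i p where i: "i \<in> mod_hom S Q (direct_sum I (\<lambda>_. ring_bimodule S id))"
    and p: "p \<in> mod_hom S (direct_sum I (\<lambda>_. ring_bimodule S id)) Q"
    and pi: "\<And>x. x \<in> carrier Q \<Longrightarrow> p (i x) = x"
    using Q by (auto simp: projective_def)
  interpret D: module_family S I "\<lambda>_. ring_bimodule S id"
    by (rule module_familyI) (rule S.left_module_axioms)
  let ?D = "direct_sum I (\<lambda>_. ring_bimodule S id)" and ?s = "ds_single I (\<lambda>_. ring_bimodule S id)"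
  have one: "?s j \<one>\<^bsub>S\<^esub> \<in> carrier ?D" if "j \<in> I" for j
    using D.ds_single_closed[OF that, of "\<one>\<^bsub>S\<^esub>"] by simp
  have "\<exists>a\<in>carrier A. e a = f (p (?s j \<one>\<^bsub>S\<^esub>))" if "j \<in> I" for j
    using e(2) mod_hom_closed[OF f mod_hom_closed[OF p one[OF that]]] by (metis imageE)
  then obtain a where a: "\<And>j. j \<in> I \<Longrightarrow> a j \<in> carrier A" "\<And>j. j \<in> I \<Longrightarrow> e (a j) = f (p (?s j \<one>\<^bsub>S\<^esub>))"
    by metis
  have ah: "(\<lambda>s. s \<odot>\<^bsub>A\<^esub> a j) \<in> mod_hom S (ring_bimodule S id) A" if "j \<in> I" for j
    by (rule mod_homI) (use a that in \<open>auto simp: A.smult_l_distr A.smult_assoc1\<close>)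
  obtain k where k: "k \<in> mod_hom S ?D A"
    and ks: "\<And>j s. \<lbrakk>j \<in> I; s \<in> carrier S\<rbrakk> \<Longrightarrow> k (?s j s) = s \<odot>\<^bsub>A\<^esub> a j"
    using D.direct_sum_universal[where h = "\<lambda>j s. s \<odot>\<^bsub>A\<^esub> a j", OF A ah] by auto
  have ek: "(\<lambda>x. e (k x)) \<in> mod_hom S ?D N" and fp: "(\<lambda>x. f (p x)) \<in> mod_hom S ?D N"
    using mod_hom_compose k e p f by blast+
  have on_single: "e (k (?s j s)) = f (p (?s j s))" if "j \<in> I" "s \<in> carrier S" for j s
  proof -
    \<comment> \<open>An element at index j is a scalar multiple of the j-th generator, so agreement
      on generators propagates by linearity.\<close>
    have "?s j s = s \<odot>\<^bsub>?D\<^esub> ?s j \<one>\<^bsub>S\<^esub>"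
      using mod_hom_smult[OF D.ds_single_hom[OF that(1)] that(2), of "\<one>\<^bsub>S\<^esub>"] that by simp
    then have "f (p (?s j s)) = s \<odot>\<^bsub>N\<^esub> e (a j)"
      using mod_hom_smult[OF fp that(2) one[OF that(1)]] a(2) that by simp
    then show ?thesis using ks that mod_hom_smult[OF e(1)] a(1) by simp
  qed
  have eq: "e (k x) = f (p x)" if "x \<in> carrier ?D" for x
    using that
  proof (induction rule: D.direct_sum_induct)
    case zero
    have zz: "h \<zero>\<^bsub>?D\<^esub> = \<zero>\<^bsub>N\<^esub>" if h: "h \<in> mod_hom S ?D N" for h
    proof -
      have "h \<zero>\<^bsub>?D\<^esub> \<oplus>\<^bsub>N\<^esub> h \<zero>\<^bsub>?D\<^esub> = h \<zero>\<^bsub>?D\<^esub>"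
        using mod_hom_add[OF h D.direct_sum_zero_closed D.direct_sum_zero_closed]
          D.l_zero[OF _ D.zero_in]
        by (simp add: D.add_direct_sum D.zero_direct_sum cong: restrict_cong)
      then show ?thesis using mod_hom_closed[OF h D.direct_sum_zero_closed] by simp
    qed
    show ?case using zz[OF ek] zz[OF fp] by simp
  next
    case (single i a)
    then show ?case using on_single by simp
  next
    case (add u v)
    then show ?case using mod_hom_add[OF ek] mod_hom_add[OF fp] by simp
  qed
  show thesis
  proof (rule that)
    show "(\<lambda>x. k (i x)) \<in> mod_hom S Q A" by (rule mod_hom_compose[OF i k])
    show "e (k (i x)) = f x" if "x \<in> carrier Q" for x
      using eq[OF mod_hom_closed[OF i that]] pi[OF that] by simp
  qed
qed

text \<open>Lift f along the epimorphism to A by projectivity, extend the lift along \<sigma> there,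
  and push the extension down to N.\<close>

lemma D_class_quotient:
  assumes Q: "projective S Q1" and \<sigma>: "\<sigma> \<in> mod_hom S Q1 Q0"
    and A: "A \<in> D_class S Q1 \<sigma> Q0" and N: "left_module S N"
    and e: "e \<in> mod_hom S A N" "e ` carrier A = carrier N"
  shows "N \<in> D_class S Q1 \<sigma> Q0"
proof -
  have "\<exists>g\<in>mod_hom S Q0 N. \<forall>x\<in>carrier Q1. g (\<sigma> x) = f x" if f: "f \<in> mod_hom S Q1 N" for f
  proof -
    obtain f' where f': "f' \<in> mod_hom S Q1 A" "\<And>x. x \<in> carrier Q1 \<Longrightarrow> e (f' x) = f x"
      using projective_lift[OF Q _ N e f] A by (auto simp: D_class_def)
    then obtain g where "g \<in> mod_hom S Q0 A" "\<forall>x\<in>carrier Q1. g (\<sigma> x) = f' x"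
      using A by (auto simp: D_class_def)
    then show ?thesis
      using mod_hom_compose[of g S Q0 A e N] e f' by (intro bexI[of _ "\<lambda>x. e (g x)"]) auto
  qed
  then show ?thesis using N by (simp add: D_class_def)
qed

section \<open>Submodules and quotient modules\<close>

locale submodule = left_module R X + additive_subgroup N X
  for R :: "('r, 'a) ring_scheme" and X :: "('r, 'x, 'b) module_scheme" and N :: "'x set" +
  assumes smult_mem: "\<lbrakk>r \<in> carrier R; n \<in> N\<rbrakk> \<Longrightarrow> r \<odot>\<^bsub>X\<^esub> n \<in> N"
begin

sublocale abelian_subgroup N X
  by (rule abelian_subgroupI3) unfold_locales

lemma carrier_quot: "carrier (quot_module X N) = (\<lambda>x. N +>\<^bsub>X\<^esub> x) ` carrier X"
  by (auto simp: quot_module_def A_RCOSETS_def')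

lemma add_quot: "\<lbrakk>x \<in> carrier X; y \<in> carrier X\<rbrakk> \<Longrightarrow>
    (N +>\<^bsub>X\<^esub> x) \<oplus>\<^bsub>quot_module X N\<^esub> (N +>\<^bsub>X\<^esub> y) = N +>\<^bsub>X\<^esub> (x \<oplus>\<^bsub>X\<^esub> y)"
  by (simp add: quot_module_def a_rcos_sum)

lemma coset_eq_iff:
  assumes "x \<in> carrier X" "y \<in> carrier X"
  shows "N +>\<^bsub>X\<^esub> x = N +>\<^bsub>X\<^esub> y \<longleftrightarrow> x \<ominus>\<^bsub>X\<^esub> y \<in> N"
proof
  assume "N +>\<^bsub>X\<^esub> x = N +>\<^bsub>X\<^esub> y"
  then have "x \<in> N +>\<^bsub>X\<^esub> y" using a_rcos_self assms by blast
  then show "x \<ominus>\<^bsub>X\<^esub> y \<in> N"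
    using a_rcos_module_minus assms M.abelian_group_axioms a_rcos_module_imp by (metis a_minus_def)
next
  assume "x \<ominus>\<^bsub>X\<^esub> y \<in> N"
  then have "x \<in> N +>\<^bsub>X\<^esub> y" using assms a_rcos_module_rev by (simp add: a_minus_def)
  then show "N +>\<^bsub>X\<^esub> x = N +>\<^bsub>X\<^esub> y" using a_repr_independence' assms a_subgroup by metis
qed

text \<open>The multiple of a coset by r, taken elementwise, may be smaller than a coset (for r zero
  it is a single element); the summand N in \<open>quot_module\<close> completes it.\<close>

lemma smult_quot:
  assumes r: "r \<in> carrier R" and x: "x \<in> carrier X"
  shows "r \<odot>\<^bsub>quot_module X N\<^esub> (N +>\<^bsub>X\<^esub> x) = N +>\<^bsub>X\<^esub> (r \<odot>\<^bsub>X\<^esub> x)"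
proof -
  have sum: "n \<oplus>\<^bsub>X\<^esub> r \<odot>\<^bsub>X\<^esub> (n' \<oplus>\<^bsub>X\<^esub> x) \<in> N +>\<^bsub>X\<^esub> (r \<odot>\<^bsub>X\<^esub> x)" if "n \<in> N" "n' \<in> N" for n n'
  proof -
    have "n \<oplus>\<^bsub>X\<^esub> r \<odot>\<^bsub>X\<^esub> (n' \<oplus>\<^bsub>X\<^esub> x) = (n \<oplus>\<^bsub>X\<^esub> r \<odot>\<^bsub>X\<^esub> n') \<oplus>\<^bsub>X\<^esub> r \<odot>\<^bsub>X\<^esub> x"
      using that r x by (simp add: smult_r_distr M.a_assoc)
    moreover have "n \<oplus>\<^bsub>X\<^esub> r \<odot>\<^bsub>X\<^esub> n' \<in> N"
      using that r smult_mem by simp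
    ultimately show ?thesis by (auto simp: a_r_coset_def')
  qed
  have "N <+>\<^bsub>X\<^esub> (\<lambda>x. r \<odot>\<^bsub>X\<^esub> x) ` (N +>\<^bsub>X\<^esub> x) = N +>\<^bsub>X\<^esub> (r \<odot>\<^bsub>X\<^esub> x)"
  proof
    show "N <+>\<^bsub>X\<^esub> (\<lambda>x. r \<odot>\<^bsub>X\<^esub> x) ` (N +>\<^bsub>X\<^esub> x) \<subseteq> N +>\<^bsub>X\<^esub> (r \<odot>\<^bsub>X\<^esub> x)"
      using sum unfolding set_add_def' by (auto simp: a_r_coset_def'[of _ _ x])
    show "N +>\<^bsub>X\<^esub> (r \<odot>\<^bsub>X\<^esub> x) \<subseteq> N <+>\<^bsub>X\<^esub> (\<lambda>x. r \<odot>\<^bsub>X\<^esub> x) ` (N +>\<^bsub>X\<^esub> x)"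
      using a_rcos_self[OF x] unfolding set_add_def' by (auto simp: a_r_coset_def'[of _ _ "r \<odot>\<^bsub>X\<^esub> x"])
  qed
  then show ?thesis by (simp add: quot_module_def)
qed

lemma left_module_quot: "left_module R (quot_module X N)"
proof -
  interpret Q: abelian_group "quot_module X N"
    by (rule abelian_group_of_comm_group[OF a_factorgroup_is_comm_group])
      (simp_all add: quot_module_def A_FactGroup_def' fun_eq_iff)
  show ?thesis
    by unfold_locales
      (auto simp: carrier_quot add_quot smult_quot smult_l_distr smult_r_distr smult_assoc1)
qed

lemma quot_hom: "(\<lambda>x. N +>\<^bsub>X\<^esub> x) \<in> mod_hom R X (quot_module X N)"
  by (rule mod_homI) (auto simp: carrier_quot add_quot smult_quot)

text \<open>Since g is constant on cosets it factors as a map of sets, and linearity is inherited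
  because the operations on cosets are computed on representatives.\<close>

lemma quot_universal:
  assumes "left_module R L" and g: "g \<in> mod_hom R X L" and N: "\<And>n. n \<in> N \<Longrightarrow> g n = \<zero>\<^bsub>L\<^esub>"
  obtains h where "h \<in> mod_hom R (quot_module X N) L" "\<And>x. x \<in> carrier X \<Longrightarrow> h (N +>\<^bsub>X\<^esub> x) = g x"
proof -
  interpret L: left_module R L by fact
  have gh: "abelian_group_hom X L g"
    using mod_hom_additive[OF g] M.abelian_group_axioms L.M.abelian_group_axioms by blast
  have "g x = g y" if "x \<in> carrier X" "y \<in> carrier X" "N +>\<^bsub>X\<^esub> x = N +>\<^bsub>X\<^esub> y" for x y
  proof -
    have "g x \<ominus>\<^bsub>L\<^esub> g y = \<zero>\<^bsub>L\<^esub>"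
      using that coset_eq_iff[of x y] abelian_group_hom_minus[OF gh] N by metis
    then show ?thesis using that mod_hom_closed[OF g] by (metis L.M.add.inv_solve_right' L.M.l_zero L.M.zero_closed a_minus_def a_inv_def)
  qed
  then obtain h where h: "\<And>x. x \<in> carrier X \<Longrightarrow> h (N +>\<^bsub>X\<^esub> x) = g x"
    using function_factors_left_gen[of "\<lambda>x. x \<in> carrier X" "\<lambda>x. N +>\<^bsub>X\<^esub> x" g] by metis
  show thesis
  proof (rule that[OF _ h])
    show "h \<in> mod_hom R (quot_module X N) L"
      by (rule mod_homI)
        (auto simp: carrier_quot add_quot smult_quot h mod_hom_closed[OF g] mod_hom_add[OF g] mod_hom_smult[OF g])
  qed
qed

end

section \<open>The functors \<open>l\<close> and \<open>q\<close>\<close>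

lemma (in bimodule) rsmult_zero_left: "a \<in> carrier R \<Longrightarrow> \<zero>\<^bsub>M\<^esub> \<odot>\<^sub>r\<^bsub>M\<^esub> a = \<zero>\<^bsub>M\<^esub>"
  using rsmult_l_distr[of "\<zero>\<^bsub>M\<^esub>" "\<zero>\<^bsub>M\<^esub>" a]
  by (metis L.M.add.r_cancel_one' L.M.l_zero L.M.zero_closed rsmult_closed)

lemma bimodule_ring_bimodule:
  assumes "ring A" "ring B" "f \<in> ring_hom A B"
  shows "bimodule B A (ring_bimodule B f)"
proof -
  interpret A: ring A by fact
  interpret B: ring B by fact
  interpret M: abelian_group "ring_bimodule B f"
    by (rule abelian_group_of_comm_group[OF B.a_comm_group]) (simp_all add: ring_bimodule_def)
  have f [simp]: "f a \<in> carrier B" if "a \<in> carrier A" for a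
    using assms(3) that by (rule ring_hom_closed)
  show ?thesis
    by unfold_locales
      (use assms(3) in \<open>simp_all add: ring_bimodule_def B.l_distr B.r_distr B.m_assoc
        ring_hom_add ring_hom_mult ring_hom_one\<close>)
qed

text \<open>The left action on the tensor product is itself a \<open>tensor_map\<close>: the action
  of s on M, the identity on X.\<close>

lemma (in tensor_product) smult_tens:
  assumes "s \<in> carrier S" "m \<in> carrier M" "x \<in> carrier X"
  shows "s \<odot>\<^bsub>tensor R M X\<^esub> tens R M X m x = tens R M X (s \<odot>\<^bsub>M\<^esub> m) x"
proof -
  have "tensor_map R M X (\<lambda>m. s \<odot>\<^bsub>M\<^esub> m) id (tens R M X m x) = tens R M X (s \<odot>\<^bsub>M\<^esub> m) (id x)"
    by (rule tensor_map_tens[OF tensor_product_axioms tensor_product_axioms])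
      (use assms in \<open>auto simp: M.L.smult_r_distr M.smult_rsmult_assoc intro: mod_homI\<close>)
  then show ?thesis by (simp add: tensor_def Let_def)
qed

section \<open>Restriction of scalars\<close>

definition restrict_scalars ::
  "['t \<Rightarrow> 'r, ('r, 'x, 'a) module_scheme] \<Rightarrow> ('t, 'x) module"
  where "restrict_scalars \<phi> L =
    \<lparr>carrier = carrier L, mult = undefined, one = undefined, ring.zero = \<zero>\<^bsub>L\<^esub>, add = add L,
     smult = (\<lambda>t x. \<phi> t \<odot>\<^bsub>L\<^esub> x)\<rparr>"

lemma restrict_scalars_simps [simp]:
  "carrier (restrict_scalars \<phi> L) = carrier L"
  "add (restrict_scalars \<phi> L) = add L"
  "\<zero>\<^bsub>restrict_scalars \<phi> L\<^esub> = \<zero>\<^bsub>L\<^esub>"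
  "t \<odot>\<^bsub>restrict_scalars \<phi> L\<^esub> x = \<phi> t \<odot>\<^bsub>L\<^esub> x"
  by (simp_all add: restrict_scalars_def)

lemma left_module_restrict_scalars:
  assumes "ring T" "\<phi> \<in> ring_hom T R" "left_module R L"
  shows "left_module T (restrict_scalars \<phi> L)"
proof -
  interpret T: ring T by fact
  interpret L: left_module R L by fact
  interpret Z: abelian_group "restrict_scalars \<phi> L"
    by (rule abelian_group_of_comm_group[OF L.M.a_comm_group]) simp_all
  show ?thesis
    by unfold_locales
      (use assms(2) in \<open>simp_all add: ring_hom_closed ring_hom_add ring_hom_mult ring_hom_one
        L.smult_l_distr L.smult_r_distr L.smult_assoc1\<close>)
qed

lemma mod_hom_restrict_scalars:
  assumes "\<phi> \<in> ring_hom T R" "f \<in> mod_hom R A B"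
  shows "f \<in> mod_hom T (restrict_scalars \<phi> A) (restrict_scalars \<phi> B)"
  using assms
  by (auto intro!: mod_homI simp: mod_hom_closed mod_hom_add mod_hom_smult ring_hom_closed)

text \<open>An equality of records rather than an isomorphism, since both sides fill the meaningless
  fields with \<open>undefined\<close>. Closure under direct sums can thus be transferred without
  passing through an isomorphism.\<close>

lemma direct_sum_restrict_scalars:
  "direct_sum I (\<lambda>i. restrict_scalars \<phi> (L i)) = restrict_scalars \<phi> (direct_sum I L)"
proof -
  have "sum_group I (\<lambda>i. add_monoid (restrict_scalars \<phi> (L i))) = sum_group I (\<lambda>i. add_monoid (L i))"
    by (simp add: sum_group_def product_group_def)
  then show ?thesis by (simp add: direct_sum_def restrict_scalars_def Let_def)
qed

section \<open>The theta-extension T and its ring homomorphisms from and to R\<close>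

locale theta_extension = M: bimodule R R M
  for R :: "'r ring" and M :: "('r, 'r, 'm) bimodule" +
  fixes \<theta> :: "('m \<times> 'm \<Rightarrow>\<^sub>0 int) set \<Rightarrow> 'm"
  assumes theta_hom: "\<theta> \<in> bimod_hom R R (tensor_bimodule R M M) M"
    and ring_T: "ring (theta_ext R M \<theta>)"
begin

abbreviation T where "T \<equiv> theta_ext R M \<theta>"

sublocale T: ring T by (rule ring_T)

sublocale MM: tensor_product R R M M ..

lemma carrier_T: "carrier T = carrier R \<times> carrier M"
  by (simp add: theta_ext_def)

text \<open>Makes r \<mapsto> (r, 0) multiplicative: the product of (r, 0) and (r', 0) has
  \<theta>(0 \<otimes> 0) in its second component. \<open>tensor_bimodule\<close> adds only a right
  action to \<open>tensor\<close>, so \<theta> is additive on the same group.\<close>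

lemma theta_zero: "\<theta> \<zero>\<^bsub>tensor R M M\<^esub> = \<zero>\<^bsub>M\<^esub>"
proof -
  have "\<theta> \<in> hom (add_monoid (tensor R M M)) (add_monoid M)"
    using theta_hom
    by (simp add: bimod_hom_def mod_hom_def tensor_bimodule_def module.extend_def hom_def
        bimodule.fields_def)
  then interpret abelian_group_hom "tensor R M M" M \<theta>
    by (intro abelian_group_homI MM.abelian_group_tensor M.L.M.abelian_group_axioms)
  show ?thesis by (rule hom_zero)
qed

lemma fst_ring_hom: "fst \<in> ring_hom T R"
  by (auto simp: theta_ext_def ring_hom_def)

lemma inclusion_ring_hom: "(\<lambda>r. (r, \<zero>\<^bsub>M\<^esub>)) \<in> ring_hom R T"
  by (auto simp: theta_ext_def ring_hom_def M.rsmult_zero_left M.L.smult_zero_right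
      MM.tens_zero_left theta_zero)

lemma fst_mem: "t \<in> carrier T \<Longrightarrow> fst t \<in> carrier R"
  by (auto simp: carrier_T)

lemma inclusion_mem: "r \<in> carrier R \<Longrightarrow> (r, \<zero>\<^bsub>M\<^esub>) \<in> carrier T"
  by (simp add: carrier_T)

lemma bimodule_l: "bimodule T R (l_bimod R M \<theta>)"
  unfolding l_bimod_def
  by (rule bimodule_ring_bimodule) (intro M.L.R.ring_axioms ring_T inclusion_ring_hom)+

lemma bimodule_q: "bimodule R T (q_bimod R)"
  unfolding q_bimod_def
  by (rule bimodule_ring_bimodule) (intro M.L.R.ring_axioms ring_T fst_ring_hom)+

lemma l_bimod_simps [simp]:
  "carrier (l_bimod R M \<theta>) = carrier T" "add (l_bimod R M \<theta>) = add T"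
  "smult (l_bimod R M \<theta>) = mult T" "t \<odot>\<^sub>r\<^bsub>l_bimod R M \<theta>\<^esub> r = t \<otimes>\<^bsub>T\<^esub> (r, \<zero>\<^bsub>M\<^esub>)"
  by (simp_all add: l_bimod_def ring_bimodule_def)

lemma q_bimod_simps [simp]:
  "carrier (q_bimod R) = carrier R" "add (q_bimod R) = add R" "\<zero>\<^bsub>q_bimod R\<^esub> = \<zero>\<^bsub>R\<^esub>"
  "smult (q_bimod R) = mult R" "r \<odot>\<^sub>r\<^bsub>q_bimod R\<^esub> t = r \<otimes>\<^bsub>R\<^esub> fst t"
  by (simp_all add: q_bimod_def ring_bimodule_def)

lemma left_module_Z: "left_module R L \<Longrightarrow> left_module T (restrict_scalars fst L)"
  by (rule left_module_restrict_scalars[OF ring_T fst_ring_hom])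

end

section \<open>The functor q and the map y \<mapsto> 1 \<otimes> y\<close>

locale q_setting = theta_extension R M \<theta> + Y: left_module "theta_ext R M \<theta>" Y
  for R :: "'r ring" and M :: "('r, 'r, 'm) bimodule" and \<theta>
    and Y :: "('r \<times> 'm, 'y, 'c) module_scheme"
begin

sublocale q: tensor_product R T "q_bimod R" Y
  by (intro tensor_product.intro bimodule_q Y.left_module_axioms)

lemma q_unit_closed: "y \<in> carrier Y \<Longrightarrow> q_unit R M \<theta> Y y \<in> carrier (q_fun R M \<theta> Y)"
  by (simp add: q_unit_def q_fun_def q.tens_closed)

lemma q_unit_add:
  "\<lbrakk>y \<in> carrier Y; y' \<in> carrier Y\<rbrakk> \<Longrightarrow>
    q_unit R M \<theta> Y (y \<oplus>\<^bsub>Y\<^esub> y') = q_unit R M \<theta> Y y \<oplus>\<^bsub>q_fun R M \<theta> Y\<^esub> q_unit R M \<theta> Y y'"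
  by (simp add: q_unit_def q_fun_def q.tens_add_right)

text \<open>The scalar t moves across the tensor sign and acts on 1 through its first component; in
  particular (0, m) y goes to 0 \<otimes> y.\<close>

lemma q_unit_smult:
  assumes "t \<in> carrier T" "y \<in> carrier Y"
  shows "q_unit R M \<theta> Y (t \<odot>\<^bsub>Y\<^esub> y) = tens T (q_bimod R) Y (fst t) y"
  using q.tens_rsmult[of "\<one>\<^bsub>R\<^esub>" t y] assms by (simp add: q_unit_def fst_mem)

lemma abelian_group_q: "abelian_group (q_fun R M \<theta> Y)"
  unfolding q_fun_def by (rule q.abelian_group_tensor)

lemma q_unit_hom: "abelian_group_hom Y (q_fun R M \<theta> Y) (q_unit R M \<theta> Y)"
  by (intro abelian_group_homI Y.M.abelian_group_axioms abelian_group_q)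
    (auto simp: hom_def q_unit_closed q_unit_add)

text \<open>By adjunction h induces r \<otimes> y \<mapsto> r h(y) on q(Y), with value h(y) at 1
  \<otimes> y. This bounds from above what \<open>q_unit\<close> can identify; it is used with
  \<kappa> for the injectivity of \<open>ql_iso\<close> and with the projection onto Coker \<alpha>
  for the fibres of \<open>q_unit\<close>.\<close>

lemma q_unit_eq_imp:
  assumes L: "left_module R L" and h: "h \<in> mod_hom T Y (restrict_scalars fst L)"
    and eq: "q_unit R M \<theta> Y y = q_unit R M \<theta> Y y'" and y: "y \<in> carrier Y" "y' \<in> carrier Y"
  shows "h y = h y'"
proof -
  interpret L: left_module R L by fact
  have hc: "h y \<in> carrier L" if "y \<in> carrier Y" for y
    using mod_hom_closed[OF h that] by simp
  have ha: "h (y \<oplus>\<^bsub>Y\<^esub> y') = h y \<oplus>\<^bsub>L\<^esub> h y'" if "y \<in> carrier Y" "y' \<in> carrier Y" for y y'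
    using mod_hom_add[OF h that] by simp
  have hs: "h (t \<odot>\<^bsub>Y\<^esub> y) = fst t \<odot>\<^bsub>L\<^esub> h y" if "t \<in> carrier T" "y \<in> carrier Y" for t y
    using mod_hom_smult[OF h that] by simp
  have "\<exists>k\<in>hom (add_monoid (tensor T (q_bimod R) Y)) (add_monoid L).
    \<forall>r\<in>carrier R. \<forall>y\<in>carrier Y. k (tens T (q_bimod R) Y r y) = r \<odot>\<^bsub>L\<^esub> h y"
    using q.tensor_universal[of L "\<lambda>r y. r \<odot>\<^bsub>L\<^esub> h y"]
    by (simp add: ha hs hc L.smult_l_distr L.smult_r_distr L.smult_assoc1 fst_mem L.M.abelian_group_axioms)
  then obtain k where "\<And>r y. \<lbrakk>r \<in> carrier R; y \<in> carrier Y\<rbrakk> \<Longrightarrow> k (tens T (q_bimod R) Y r y) = r \<odot>\<^bsub>L\<^esub> h y"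
    by auto
  from this[of "\<one>\<^bsub>R\<^esub>" y] this[of "\<one>\<^bsub>R\<^esub>" y'] show ?thesis
    using eq y hc by (simp add: q_unit_def)
qed

end

text \<open>Naturality of y \<mapsto> 1 \<otimes> y.\<close>

lemma (in theta_extension) q_map_unit:
  assumes "left_module T Y" "left_module T Y'" "f \<in> mod_hom T Y Y'" "y \<in> carrier Y"
  shows "q_map R M \<theta> Y' f (q_unit R M \<theta> Y y) = q_unit R M \<theta> Y' (f y)"
proof -
  interpret Y: q_setting R M \<theta> Y by (intro q_setting.intro theta_extension_axioms assms)
  interpret Y': q_setting R M \<theta> Y' by (intro q_setting.intro theta_extension_axioms assms)
  show ?thesis
    unfolding q_map_def q_unit_def
    using tensor_map_tens[OF Y'.q.tensor_product_axioms Y.q.tensor_product_axioms, of id f "\<one>\<^bsub>R\<^esub>" y] assms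
    by simp
qed

section \<open>The modules l(P) and the maps between P, l(P) and q(l(P))\<close>

locale l_setting = theta_extension R M \<theta> + P: left_module R P
  for R :: "'r ring" and M :: "('r, 'r, 'm) bimodule" and \<theta>
    and P :: "('r, 'p) module" +
  assumes left_module_l: "left_module (theta_ext R M \<theta>) (l_fun R M \<theta> P)"
begin

abbreviation lP where "lP \<equiv> l_fun R M \<theta> P"

sublocale lt: tensor_product T R "l_bimod R M \<theta>" P
  by (intro tensor_product.intro bimodule_l P.left_module_axioms)

sublocale l: left_module T lP by (rule left_module_l)

sublocale ql: q_setting R M \<theta> lP ..

text \<open>
  \<open>\<eta>\<close> is the unit of the adjunction between \<open>l\<close> and restriction along \<open>R \<rightarrow> T\<close>, and \<open>\<kappa>\<close> is the map
  \<open>l P \<rightarrow> P\<close> that induces the inverse of \<open>ql_iso\<close>.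
\<close>

definition \<eta> where "\<eta> p = tens R (l_bimod R M \<theta>) P \<one>\<^bsub>T\<^esub> p"

lemma ex_\<kappa>: "\<exists>h. h \<in> hom (add_monoid lP) (add_monoid P) \<and>
    (\<forall>t\<in>carrier T. \<forall>p\<in>carrier P. h (tens R (l_bimod R M \<theta>) P t p) = fst t \<odot>\<^bsub>P\<^esub> p)"
proof -
  have "fst (t \<otimes>\<^bsub>T\<^esub> (r, \<zero>\<^bsub>M\<^esub>)) = fst t \<otimes>\<^bsub>R\<^esub> r"
    if "t \<in> carrier T" "r \<in> carrier R" for t r
    using ring_hom_mult[OF fst_ring_hom that(1) inclusion_mem[OF that(2)]] by simp
  moreover have "fst (t \<oplus>\<^bsub>T\<^esub> t') = fst t \<oplus>\<^bsub>R\<^esub> fst t'" if "t \<in> carrier T" "t' \<in> carrier T" for t t'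
    using ring_hom_add[OF fst_ring_hom that] .
  ultimately have "\<exists>h\<in>hom (add_monoid (tensor R (l_bimod R M \<theta>) P)) (add_monoid P).
    \<forall>t\<in>carrier (l_bimod R M \<theta>). \<forall>p\<in>carrier P. h (tens R (l_bimod R M \<theta>) P t p) = fst t \<odot>\<^bsub>P\<^esub> p"
    by (intro lt.tensor_universal)
      (simp_all add: P.smult_l_distr P.smult_r_distr P.smult_assoc1 fst_mem P.M.abelian_group_axioms)
  then show ?thesis by (auto simp: l_fun_def)
qed

definition \<kappa> where "\<kappa> = (SOME h. h \<in> hom (add_monoid lP) (add_monoid P) \<and>
    (\<forall>t\<in>carrier T. \<forall>p\<in>carrier P. h (tens R (l_bimod R M \<theta>) P t p) = fst t \<odot>\<^bsub>P\<^esub> p))"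

lemma \<kappa>_tens:
  "\<lbrakk>t \<in> carrier T; p \<in> carrier P\<rbrakk> \<Longrightarrow> \<kappa> (tens R (l_bimod R M \<theta>) P t p) = fst t \<odot>\<^bsub>P\<^esub> p"
  using someI_ex[OF ex_\<kappa>] unfolding \<kappa>_def by blast

lemma \<kappa>_additive: "abelian_group_hom lP P \<kappa>"
  using someI_ex[OF ex_\<kappa>] unfolding \<kappa>_def
  by (intro abelian_group_homI l.M.abelian_group_axioms P.M.abelian_group_axioms) blast

lemma tens_mem: "\<lbrakk>t \<in> carrier T; p \<in> carrier P\<rbrakk> \<Longrightarrow> tens R (l_bimod R M \<theta>) P t p \<in> carrier lP"
  by (simp add: l_fun_def)

lemma \<eta>_mem: "p \<in> carrier P \<Longrightarrow> \<eta> p \<in> carrier lP"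
  by (simp add: \<eta>_def tens_mem)

lemma \<eta>_add: "\<lbrakk>p \<in> carrier P; p' \<in> carrier P\<rbrakk> \<Longrightarrow> \<eta> (p \<oplus>\<^bsub>P\<^esub> p') = \<eta> p \<oplus>\<^bsub>lP\<^esub> \<eta> p'"
  by (simp add: \<eta>_def l_fun_def lt.tens_add_right)

lemma \<eta>_additive: "abelian_group_hom P lP \<eta>"
  by (intro abelian_group_homI l.M.abelian_group_axioms P.M.abelian_group_axioms)
    (auto simp: hom_def \<eta>_mem \<eta>_add)

lemma l_smult_tens: "\<lbrakk>s \<in> carrier T; t \<in> carrier T; p \<in> carrier P\<rbrakk> \<Longrightarrow>
    s \<odot>\<^bsub>lP\<^esub> tens R (l_bimod R M \<theta>) P t p = tens R (l_bimod R M \<theta>) P (s \<otimes>\<^bsub>T\<^esub> t) p"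
  using lt.smult_tens[of s t p] by (simp add: l_fun_def)

text \<open>Shows that l(P) is generated over T by the image of \<eta>.\<close>

lemma tens_eq_smult_\<eta>: "\<lbrakk>t \<in> carrier T; p \<in> carrier P\<rbrakk> \<Longrightarrow>
    tens R (l_bimod R M \<theta>) P t p = t \<odot>\<^bsub>lP\<^esub> \<eta> p"
  by (simp add: \<eta>_def l_smult_tens)

lemma \<eta>_smult: "\<lbrakk>r \<in> carrier R; p \<in> carrier P\<rbrakk> \<Longrightarrow> \<eta> (r \<odot>\<^bsub>P\<^esub> p) = (r, \<zero>\<^bsub>M\<^esub>) \<odot>\<^bsub>lP\<^esub> \<eta> p"
  using lt.tens_rsmult[of "\<one>\<^bsub>T\<^esub>" r p]
  by (simp add: \<eta>_def l_smult_tens inclusion_mem)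

lemma \<kappa>_\<eta>: "p \<in> carrier P \<Longrightarrow> \<kappa> (\<eta> p) = p"
  using ring_hom_one[OF fst_ring_hom] by (simp add: \<eta>_def \<kappa>_tens)

lemma l_induct [consumes 1, case_names zero tens minus]:
  assumes "w \<in> carrier lP" "P' \<zero>\<^bsub>lP\<^esub>"
    and "\<And>t p. \<lbrakk>t \<in> carrier T; p \<in> carrier P\<rbrakk> \<Longrightarrow> P' (tens R (l_bimod R M \<theta>) P t p)"
    and "\<And>u v. \<lbrakk>u \<in> carrier lP; v \<in> carrier lP; P' u; P' v\<rbrakk> \<Longrightarrow> P' (u \<ominus>\<^bsub>lP\<^esub> v)"
  shows "P' w"
  using lt.tensor_induct[of w P'] assms unfolding l_fun_def by simp

lemma \<kappa>_mem: "w \<in> carrier lP \<Longrightarrow> \<kappa> w \<in> carrier P"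
  using abelian_group_hom.hom_closed[OF \<kappa>_additive] by blast

text \<open>Modulo the action of \<open>M\<close>, every \<open>w\<close> equals \<open>\<eta> (\<kappa> w)\<close>.\<close>

lemma additive_factor:
  assumes A: "abelian_group_hom lP A g"
    and g: "\<And>t w. \<lbrakk>t \<in> carrier T; w \<in> carrier lP\<rbrakk> \<Longrightarrow>
      g (t \<odot>\<^bsub>lP\<^esub> w) = g ((fst t, \<zero>\<^bsub>M\<^esub>) \<odot>\<^bsub>lP\<^esub> w)"
    and w: "w \<in> carrier lP"
  shows "g (\<eta> (\<kappa> w)) = g w"
  using w
proof (induction rule: l_induct)
  case zero
  show ?case
    using abelian_group_hom.hom_zero[OF \<kappa>_additive] abelian_group_hom.hom_zero[OF \<eta>_additive] by simp
next
  case (tens t p)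
  then have "g (\<eta> (\<kappa> (tens R (l_bimod R M \<theta>) P t p))) = g ((fst t, \<zero>\<^bsub>M\<^esub>) \<odot>\<^bsub>lP\<^esub> \<eta> p)"
    by (simp add: \<kappa>_tens \<eta>_smult fst_mem)
  with tens show ?case
    by (simp add: tens_eq_smult_\<eta> g \<eta>_mem)
next
  case (minus u v)
  then show ?case
    by (simp add: abelian_group_hom_minus[OF \<kappa>_additive] abelian_group_hom_minus[OF \<eta>_additive]
        abelian_group_hom_minus[OF A] \<kappa>_mem \<eta>_mem)
qed

text \<open>\<kappa> comes from the universal property and so is additive only; linearity is read
  off on elementary tensors from the multiplicativity of \<open>fst\<close>.\<close>

lemma \<kappa>_smult:
  assumes s: "s \<in> carrier T" and w: "w \<in> carrier lP"
  shows "\<kappa> (s \<odot>\<^bsub>lP\<^esub> w) = fst s \<odot>\<^bsub>P\<^esub> \<kappa> w"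
  using w
proof (induction rule: l_induct)
  case zero
  show ?case
    using abelian_group_hom.hom_zero[OF \<kappa>_additive] s
    by (simp add: l.smult_zero_right P.smult_zero_right fst_mem)
next
  case (tens t p)
  then show ?case
    using s ring_hom_mult[OF fst_ring_hom s tens(1)]
    by (simp add: l_smult_tens \<kappa>_tens P.smult_assoc1 fst_mem)
next
  case (minus u v)
  interpret a: abelian_group_hom lP lP "\<lambda>w. s \<odot>\<^bsub>lP\<^esub> w"
    by (intro abelian_group_homI l.M.abelian_group_axioms) (auto simp: hom_def s l.smult_r_distr)
  interpret b: abelian_group_hom P P "\<lambda>p. fst s \<odot>\<^bsub>P\<^esub> p"
    by (intro abelian_group_homI P.M.abelian_group_axioms) (auto simp: hom_def s P.smult_r_distr fst_mem)
  show ?case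
    using minus s
    by (simp add: abelian_group_hom_minus[OF a.abelian_group_hom_axioms]
        abelian_group_hom_minus[OF b.abelian_group_hom_axioms]
        abelian_group_hom_minus[OF \<kappa>_additive] \<kappa>_mem)
qed

lemma \<kappa>_hom: "\<kappa> \<in> mod_hom T lP (restrict_scalars fst P)"
  using abelian_group_hom.hom_add[OF \<kappa>_additive]
  by (auto intro!: mod_homI simp: \<kappa>_mem \<kappa>_smult)

text \<open>M acts as zero on a restricted module, so g cannot distinguish t from (fst t, 0).
  Together with \<open>hom_\<eta>\<close> and \<open>hom_\<kappa>\<close> this makes f \<mapsto> f
  \<kappa> and g \<mapsto> g \<eta> mutually inverse bijections between Hom_R(P, L) and the
  T-homomorphisms from l(P) to the restriction of L.\<close>

lemma hom_factor:
  assumes L: "left_module R L" and g: "g \<in> mod_hom T lP (restrict_scalars fst L)"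
    and w: "w \<in> carrier lP"
  shows "g (\<eta> (\<kappa> w)) = g w"
proof (rule additive_factor[OF mod_hom_additive[OF g] _ w])
  show "abelian_group (restrict_scalars fst L :: ('r \<times> 'm, _) module)"
    using left_module_Z[OF L] by (simp add: left_module.axioms(2))
qed (use mod_hom_smult[OF g] l.M.abelian_group_axioms in \<open>simp_all add: fst_mem inclusion_mem\<close>)

lemma hom_\<eta>:
  assumes g: "g \<in> mod_hom T lP (restrict_scalars fst L)"
  shows "(\<lambda>p. g (\<eta> p)) \<in> mod_hom R P L"
  using mod_hom_closed[OF g] mod_hom_add[OF g] mod_hom_smult[OF g]
  by (auto intro!: mod_homI simp: \<eta>_mem \<eta>_add \<eta>_smult inclusion_mem)

lemma hom_\<kappa>:
  assumes f: "f \<in> mod_hom R P L"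
  shows "(\<lambda>w. f (\<kappa> w)) \<in> mod_hom T lP (restrict_scalars fst L)"
  by (rule mod_hom_compose[OF \<kappa>_hom mod_hom_restrict_scalars[OF fst_ring_hom f]])

lemma ql_iso_eq: "ql_iso R M \<theta> P p = q_unit R M \<theta> lP (\<eta> p)"
  by (simp add: ql_iso_def \<eta>_def)

text \<open>In q(l(P)) the scalars t and (fst t, 0) both move to \<open>fst t\<close> in the left
  factor. The lemma exhibits a preimage under \<open>ql_iso\<close>, which is what evaluates the
  inverse in \<open>q_delta\<close>.\<close>

lemma q_unit_\<eta>_\<kappa>: "w \<in> carrier lP \<Longrightarrow> q_unit R M \<theta> lP w = ql_iso R M \<theta> P (\<kappa> w)"
  unfolding ql_iso_eq
  by (rule additive_factor[OF ql.q_unit_hom, symmetric])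
    (simp_all add: ql.q_unit_smult inclusion_mem fst_mem)

text \<open>\<kappa> factors through q(l(P)) and inverts \<eta> on the left.\<close>

lemma ql_iso_inj: "inj_on (ql_iso R M \<theta> P) (carrier P)"
  by (rule inj_onI)
    (metis P.left_module_axioms \<kappa>_\<eta> \<kappa>_hom \<eta>_mem ql.q_unit_eq_imp ql_iso_eq)

end

section \<open>Transfer along restriction of scalars\<close>

text \<open>The additive monoids of a module and of its restriction are records of different types,
  because the type of the scalars enters the record; only their fields can be compared.\<close>

lemma generate_cong:
  assumes "carrier G = carrier H" "mult G = mult H" "one G = one H"
  shows "generate G S = generate H S"
proof -
  have inv: "m_inv G = m_inv H" using assms by (simp add: m_inv_def fun_eq_iff)
  have "x \<in> generate G S \<longleftrightarrow> x \<in> generate H S" for x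
  proof
    show "x \<in> generate H S" if "x \<in> generate G S"
      using that by induction (auto simp: assms inv intro: generate.intros)
    show "x \<in> generate G S" if "x \<in> generate H S"
      using that by induction (auto simp: assms[symmetric] inv[symmetric] intro: generate.intros)
  qed
  then show ?thesis by blast
qed

section \<open>The presentation of (X, \<alpha>) and the cokernel of \<alpha>\<close>

locale theta_presentation =
  theta_extension R M \<theta> + X: left_module R X + l1: l_setting R M \<theta> P1 + l0: l_setting R M \<theta> P0
  for R :: "'r ring" and M :: "('r, 'r, 'm) bimodule" and \<theta>
    and X :: "('r, 'x) module" and P1 :: "('r, 'y) module" and P0 :: "('r, 'z) module" +
  fixes \<alpha> :: "('m \<times> 'x \<Rightarrow>\<^sub>0 int) set \<Rightarrow> 'x"
    and \<delta> :: "(('r \<times> 'm) \<times> 'y \<Rightarrow>\<^sub>0 int) set \<Rightarrow> (('r \<times> 'm) \<times> 'z \<Rightarrow>\<^sub>0 int) set"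
    and \<epsilon> :: "(('r \<times> 'm) \<times> 'z \<Rightarrow>\<^sub>0 int) set \<Rightarrow> 'x"
  assumes alpha_hom: "\<alpha> \<in> mod_hom R (tensor R M X) X"
    and projective_P1: "projective R P1" and projective_P0: "projective R P0"
    and presentation: "projective_presentation (theta_ext R M \<theta>)
           (l_fun R M \<theta> P1) \<delta> (l_fun R M \<theta> P0) \<epsilon> (pair_module R M X \<alpha>)"
begin

abbreviation XA where "XA \<equiv> pair_module R M X \<alpha>"
abbreviation N where "N \<equiv> \<alpha> ` carrier (tensor R M X)"
abbreviation C where "C \<equiv> coker (tensor R M X) X \<alpha>"
abbreviation \<pi> where "\<pi> x \<equiv> N +>\<^bsub>X\<^esub> x"

lemma delta_hom: "\<delta> \<in> mod_hom T l1.lP l0.lP"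
  and epsilon_hom: "\<epsilon> \<in> mod_hom T l0.lP XA"
  and exact: "\<delta> ` carrier l1.lP = a_kernel l0.lP XA \<epsilon>"
  and surj: "\<epsilon> ` carrier l0.lP = carrier XA"
  and projective_l1: "projective T l1.lP"
  and left_module_XA: "left_module T XA"
  using presentation by (simp_all add: projective_presentation_def)

sublocale MX: tensor_product R R M X ..

sublocale XA: left_module T XA by (rule left_module_XA)

sublocale qX: q_setting R M \<theta> XA ..

sublocale \<alpha>: abelian_group_hom "tensor R M X" X \<alpha>
  by (rule mod_hom_additive[OF alpha_hom MX.abelian_group_tensor X.M.abelian_group_axioms])

lemma XA_simps [simp]: "carrier XA = carrier X" "add XA = add X" "\<zero>\<^bsub>XA\<^esub> = \<zero>\<^bsub>X\<^esub>"
  by (simp_all add: pair_module_def)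

lemma smult_XA: "t \<odot>\<^bsub>XA\<^esub> x = fst t \<odot>\<^bsub>X\<^esub> x \<oplus>\<^bsub>X\<^esub> \<alpha> (tens R M X (snd t) x)"
  by (simp add: pair_module_def split: prod.split)

lemma uminus_XA [simp]: "\<ominus>\<^bsub>XA\<^esub> x = \<ominus>\<^bsub>X\<^esub> x"
  by (simp add: a_inv_def m_inv_def)

lemma minus_XA: "x \<ominus>\<^bsub>XA\<^esub> y = x \<ominus>\<^bsub>X\<^esub> y"
  by (simp add: a_minus_def)

lemma smult_XA_M: "\<lbrakk>m \<in> carrier M; x \<in> carrier X\<rbrakk> \<Longrightarrow> (\<zero>\<^bsub>R\<^esub>, m) \<odot>\<^bsub>XA\<^esub> x = \<alpha> (tens R M X m x)"
  using mod_hom_closed[OF alpha_hom MX.tens_closed] by (simp add: smult_XA X.smult_zero_left)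

text \<open>Linearity of \<alpha> turns r \<alpha>(w) into \<alpha>(r w), but the action of r on the
  tensor product is controlled on elementary tensors only (\<open>smult_tens\<close>); hence the
  induction.\<close>

sublocale N: submodule R X N
proof -
  have N_sub: "additive_subgroup N X"
    using \<alpha>.a_group_hom group_hom.img_is_subgroup by (fastforce intro: additive_subgroup.intro)
  interpret N: additive_subgroup N X by (rule N_sub)
  have "r \<odot>\<^bsub>X\<^esub> \<alpha> w \<in> N" if r: "r \<in> carrier R" and w: "w \<in> carrier (tensor R M X)" for r w
    using w
  proof (induction rule: MX.tensor_induct)
    case zero
    then show ?case using r by (simp add: X.smult_zero_right)
  next
    case (tens m x)
    then show ?case
      using mod_hom_smult[OF alpha_hom r MX.tens_closed[OF tens]] MX.smult_tens[OF r tens] r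
        MX.tens_closed[of "r \<odot>\<^bsub>M\<^esub> m" x] by (metis M.L.smult_closed imageI)
  next
    case (minus u v)
    interpret b: abelian_group_hom X X "\<lambda>p. r \<odot>\<^bsub>X\<^esub> p"
      by (intro abelian_group_homI X.M.abelian_group_axioms) (auto simp: hom_def r X.smult_r_distr)
    show ?case
      using minus
      by (simp add: abelian_group_hom_minus[OF b.abelian_group_hom_axioms]
          abelian_group_hom_minus[OF \<alpha>.abelian_group_hom_axioms] a_minus_def)
  qed
  then show "submodule R X N"
    by (auto intro!: submodule.intro submodule_axioms.intro X.left_module_axioms N_sub)
qed

lemma C_eq: "C = quot_module X N"
  by (simp add: coker_def)

lemma left_module_C: "left_module R C"
  unfolding C_eq by (rule N.left_module_quot)

lemma \<pi>_hom: "\<pi> \<in> mod_hom R X C"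
  unfolding C_eq by (rule N.quot_hom)

lemma carrier_C: "carrier C = \<pi> ` carrier X"
  by (simp add: C_eq N.carrier_quot)

lemma \<pi>_N: "n \<in> N \<Longrightarrow> \<pi> n = \<zero>\<^bsub>C\<^esub>"
  using N.a_rcos_const by (simp add: C_eq quot_module_def)

text \<open>The second component of t acts on X through \<alpha>, and that part vanishes in the
  cokernel.\<close>

lemma \<pi>_hom_XA: "\<pi> \<in> mod_hom T XA (restrict_scalars fst C)"
proof (rule mod_homI)
  interpret C: left_module R C by (rule left_module_C)
  fix t x assume t: "t \<in> carrier T" and x: "x \<in> carrier XA"
  have m: "tens R M X (snd t) x \<in> carrier (tensor R M X)"
    using t x by (auto simp: carrier_T)
  have "\<pi> (t \<odot>\<^bsub>XA\<^esub> x) = \<pi> (fst t \<odot>\<^bsub>X\<^esub> x) \<oplus>\<^bsub>C\<^esub> \<pi> (\<alpha> (tens R M X (snd t) x))"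
    unfolding smult_XA by (rule mod_hom_add[OF \<pi>_hom]) (use t x m in \<open>auto simp: fst_mem\<close>)
  also have "\<pi> (\<alpha> (tens R M X (snd t) x)) = \<zero>\<^bsub>C\<^esub>" using m by (intro \<pi>_N) simp
  finally show "\<pi> (t \<odot>\<^bsub>XA\<^esub> x) = t \<odot>\<^bsub>restrict_scalars fst C\<^esub> \<pi> x"
    using t x mod_hom_smult[OF \<pi>_hom] mod_hom_closed[OF \<pi>_hom] by (simp add: fst_mem)
qed (use mod_hom_closed[OF \<pi>_hom] mod_hom_add[OF \<pi>_hom] in auto)

text \<open>On generators, 1 \<otimes> \<alpha>(m \<otimes> x) = 1 \<otimes> (0, m) x = 0 \<otimes>
  x = 0.\<close>

lemma q_unit_N:
  assumes "w \<in> carrier (tensor R M X)"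
  shows "q_unit R M \<theta> XA (\<alpha> w) = \<zero>\<^bsub>q_fun R M \<theta> XA\<^esub>"
  using assms
proof (induction rule: MX.tensor_induct)
  case zero
  then show ?case using abelian_group_hom.hom_zero[OF qX.q_unit_hom] by simp
next
  case (tens m x)
  then have "q_unit R M \<theta> XA (\<alpha> (tens R M X m x)) = tens T (q_bimod R) XA \<zero>\<^bsub>R\<^esub> x"
    using qX.q_unit_smult[of "(\<zero>\<^bsub>R\<^esub>, m)" x] by (simp add: smult_XA_M carrier_T)
  then show ?case using qX.q.tens_zero_left[of x] tens by (simp add: q_fun_def)
next
  case (minus u v)
  interpret q: abelian_group "q_fun R M \<theta> XA" by (rule qX.abelian_group_q)
  show ?case
    using minus abelian_group_hom_minus[OF qX.q_unit_hom, of "\<alpha> u" "\<alpha> v"]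
    by (simp add: abelian_group_hom_minus[OF \<alpha>.abelian_group_hom_axioms] minus_XA q.minus_eq)
qed

text \<open>The isomorphism of q(X, \<alpha>) with Coker \<alpha>, seen on fibres: they are no
  larger than cosets because the projection factors through q(X, \<alpha>), and no smaller because
  \<open>q_unit\<close> kills Im \<alpha>.\<close>

lemma q_to_coker_unit:
  assumes y: "y \<in> carrier X"
  shows "q_to_coker R M \<theta> X \<alpha> (q_unit R M \<theta> XA y) = \<pi> y"
proof (intro equalityI subsetI)
  fix x assume "x \<in> q_to_coker R M \<theta> X \<alpha> (q_unit R M \<theta> XA y)"
  then have x: "x \<in> carrier X" "q_unit R M \<theta> XA x = q_unit R M \<theta> XA y"
    by (auto simp: q_to_coker_def)
  have "\<pi> x = \<pi> y"
    by (rule qX.q_unit_eq_imp[OF left_module_C \<pi>_hom_XA x(2)]) (use x y in auto)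
  then show "x \<in> \<pi> y" using N.a_rcos_self[OF x(1)] by simp
next
  interpret q: abelian_group "q_fun R M \<theta> XA" by (rule qX.abelian_group_q)
  fix x assume "x \<in> \<pi> y"
  then obtain w where w: "w \<in> carrier (tensor R M X)" "x = \<alpha> w \<oplus>\<^bsub>X\<^esub> y"
    by (auto simp: a_r_coset_def')
  then show "x \<in> q_to_coker R M \<theta> X \<alpha> (q_unit R M \<theta> XA y)"
    using y qX.q_unit_add[of "\<alpha> w" y] q_unit_N[OF w(1)] qX.q_unit_closed[of y]
    by (simp add: q_to_coker_def)
qed

abbreviation \<sigma> where "\<sigma> \<equiv> q_delta R M \<theta> P1 P0 \<delta>"

text \<open>Naturality takes 1 \<otimes> \<eta>(p) to 1 \<otimes> \<delta>(\<eta>(p)), which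
  \<open>q_unit_\<eta>_\<kappa>\<close> recognises as a value of the injective map
  \<open>ql_iso\<close>; there \<open>inv_into\<close> can be evaluated.\<close>

lemma q_delta_eq:
  assumes "p \<in> carrier P1"
  shows "\<sigma> p = l0.\<kappa> (\<delta> (l1.\<eta> p))"
proof -
  have d: "\<delta> (l1.\<eta> p) \<in> carrier l0.lP"
    using mod_hom_closed[OF delta_hom] l1.\<eta>_mem assms by blast
  have "q_map R M \<theta> l0.lP \<delta> (ql_iso R M \<theta> P1 p) = ql_iso R M \<theta> P0 (l0.\<kappa> (\<delta> (l1.\<eta> p)))"
    unfolding l1.ql_iso_eq l0.q_unit_\<eta>_\<kappa>[OF d, symmetric]
    by (rule q_map_unit[OF l1.left_module_l l0.left_module_l delta_hom l1.\<eta>_mem[OF assms]])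
  then show ?thesis
    by (simp add: q_delta_def inv_into_f_f[OF l0.ql_iso_inj] l0.\<kappa>_mem d)
qed

lemma q_epsilon_eq:
  assumes "p \<in> carrier P0"
  shows "q_epsilon R M \<theta> P0 X \<alpha> \<epsilon> p = \<pi> (\<epsilon> (l0.\<eta> p))"
proof -
  have e: "\<epsilon> (l0.\<eta> p) \<in> carrier X"
    using mod_hom_closed[OF epsilon_hom] l0.\<eta>_mem assms by force
  have "q_map R M \<theta> XA \<epsilon> (ql_iso R M \<theta> P0 p) = q_unit R M \<theta> XA (\<epsilon> (l0.\<eta> p))"
    unfolding l0.ql_iso_eq
    by (rule q_map_unit[OF l0.left_module_l left_module_XA epsilon_hom l0.\<eta>_mem[OF assms]])
  then show ?thesis by (simp add: q_epsilon_def q_to_coker_unit[OF e])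
qed

lemma \<kappa>_\<delta>_hom: "(\<lambda>v. l0.\<kappa> (\<delta> v)) \<in> mod_hom T l1.lP (restrict_scalars fst P0)"
  by (rule mod_hom_compose[OF delta_hom l0.\<kappa>_hom])

text \<open>The commuting square behind all transfers: \<kappa> \<delta> is a T-homomorphism into
  the restriction of P0, hence factors through \<kappa>.\<close>

lemma \<kappa>_\<delta>: "v \<in> carrier l1.lP \<Longrightarrow> l0.\<kappa> (\<delta> v) = \<sigma> (l1.\<kappa> v)"
  using l1.hom_factor[OF l0.P.left_module_axioms \<kappa>_\<delta>_hom] by (simp add: q_delta_eq l1.\<kappa>_mem)

lemma q_delta_hom: "\<sigma> \<in> mod_hom R P1 P0"
proof -
  have h: "(\<lambda>p. l0.\<kappa> (\<delta> (l1.\<eta> p))) \<in> mod_hom R P1 P0" by (rule l1.hom_\<eta>[OF \<kappa>_\<delta>_hom])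
  show ?thesis
    by (rule mod_homI) (simp_all add: q_delta_eq mod_hom_closed[OF h] mod_hom_add[OF h] mod_hom_smult[OF h])
qed

lemma \<pi>_\<epsilon>_hom: "(\<lambda>w. \<pi> (\<epsilon> w)) \<in> mod_hom T l0.lP (restrict_scalars fst C)"
  by (rule mod_hom_compose[OF epsilon_hom \<pi>_hom_XA])

lemma q_epsilon_\<kappa>: "w \<in> carrier l0.lP \<Longrightarrow> q_epsilon R M \<theta> P0 X \<alpha> \<epsilon> (l0.\<kappa> w) = \<pi> (\<epsilon> w)"
  using l0.hom_factor[OF left_module_C \<pi>_\<epsilon>_hom] by (simp add: q_epsilon_eq l0.\<kappa>_mem)

lemma q_epsilon_hom: "q_epsilon R M \<theta> P0 X \<alpha> \<epsilon> \<in> mod_hom R P0 C"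
proof -
  have h: "(\<lambda>p. \<pi> (\<epsilon> (l0.\<eta> p))) \<in> mod_hom R P0 C" by (rule l0.hom_\<eta>[OF \<pi>_\<epsilon>_hom])
  show ?thesis
    by (rule mod_homI) (simp_all add: q_epsilon_eq mod_hom_closed[OF h] mod_hom_add[OF h] mod_hom_smult[OF h])
qed

lemma epsilon_additive: "abelian_group_hom l0.lP XA \<epsilon>"
  by (rule mod_hom_additive[OF epsilon_hom l0.l.M.abelian_group_axioms XA.M.abelian_group_axioms])

text \<open>Gives exactness at \<open>P0\<close>: the image of \<open>\<alpha>\<close> is already hit by the kernel of \<open>\<kappa>\<close>.\<close>

lemma N_lift:
  assumes "w \<in> carrier (tensor R M X)"
  shows "\<exists>v\<in>carrier l0.lP. l0.\<kappa> v = \<zero>\<^bsub>P0\<^esub> \<and> \<epsilon> v = \<alpha> w"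
  using assms
proof (induction rule: MX.tensor_induct)
  case zero
  then show ?case
    using abelian_group_hom.hom_zero[OF epsilon_additive] abelian_group_hom.hom_zero[OF l0.\<kappa>_additive]
    by (intro bexI[of _ "\<zero>\<^bsub>l0.lP\<^esub>"]) auto
next
  case (tens m x)
  then have "x \<in> \<epsilon> ` carrier l0.lP" unfolding surj by simp
  then obtain v where v: "v \<in> carrier l0.lP" "x = \<epsilon> v" by blast
  \<comment> \<open>Acting by (0, m) on a lift v of x gives a lift of \<alpha>(m \<otimes> x), and
    \<kappa> kills it since the first component is zero.\<close>
  have m: "(\<zero>\<^bsub>R\<^esub>, m) \<in> carrier T" using tens by (simp add: carrier_T)
  have "\<epsilon> ((\<zero>\<^bsub>R\<^esub>, m) \<odot>\<^bsub>l0.lP\<^esub> v) = \<alpha> (tens R M X m x)"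
    using mod_hom_smult[OF epsilon_hom m v(1)] tens v by (simp add: smult_XA_M)
  moreover have "l0.\<kappa> ((\<zero>\<^bsub>R\<^esub>, m) \<odot>\<^bsub>l0.lP\<^esub> v) = \<zero>\<^bsub>P0\<^esub>"
    using l0.\<kappa>_smult[OF m v(1)] v by (simp add: l0.P.smult_zero_left l0.\<kappa>_mem)
  ultimately show ?case using m v by blast
next
  case (minus a b)
  then obtain u v where "u \<in> carrier l0.lP" "l0.\<kappa> u = \<zero>\<^bsub>P0\<^esub>" "\<epsilon> u = \<alpha> a"
    "v \<in> carrier l0.lP" "l0.\<kappa> v = \<zero>\<^bsub>P0\<^esub>" "\<epsilon> v = \<alpha> b" by blast
  with minus show ?case
    by (intro bexI[of _ "u \<ominus>\<^bsub>l0.lP\<^esub> v"])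
      (simp_all add: abelian_group_hom_minus[OF epsilon_additive] abelian_group_hom_minus[OF l0.\<kappa>_additive]
        abelian_group_hom_minus[OF \<alpha>.abelian_group_hom_axioms] minus_XA l0.P.M.minus_eq)
qed

text \<open>Both maps are determined by \<kappa> \<delta> and \<pi> \<epsilon> on l(P1) and l(P0),
  so exactness is checked upstairs. There \<epsilon>(\<eta>(p)) need only lie in Im \<alpha>, not
  vanish, and \<eta>(p) must first be corrected.\<close>

lemma presentation_coker: "projective_presentation R P1 \<sigma> P0 (q_epsilon R M \<theta> P0 X \<alpha> \<epsilon>) C"
proof -
  interpret C: left_module R C by (rule left_module_C)
  let ?e = "q_epsilon R M \<theta> P0 X \<alpha> \<epsilon>"
  have ker: "a_kernel P0 C ?e = {p \<in> carrier P0. ?e p = \<zero>\<^bsub>C\<^esub>}"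
    by (simp add: a_kernel_def')
  have kerT: "a_kernel l0.lP XA \<epsilon> = {w \<in> carrier l0.lP. \<epsilon> w = \<zero>\<^bsub>X\<^esub>}"
    by (simp add: a_kernel_def')
  have "\<sigma> p \<in> a_kernel P0 C ?e" if "p \<in> carrier P1" for p
  proof -
    have d: "\<delta> (l1.\<eta> p) \<in> carrier l0.lP" "\<epsilon> (\<delta> (l1.\<eta> p)) = \<zero>\<^bsub>X\<^esub>"
      using exact l1.\<eta>_mem[OF that] unfolding kerT by blast+
    then have "?e (\<sigma> p) = \<pi> \<zero>\<^bsub>X\<^esub>"
      using that q_epsilon_\<kappa>[OF d(1)] by (simp add: q_delta_eq)
    also have "\<dots> = \<zero>\<^bsub>C\<^esub>" by (rule \<pi>_N) simp
    finally show ?thesis using mod_hom_closed[OF q_delta_hom that] by (simp add: ker)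
  qed
  moreover have "p \<in> \<sigma> ` carrier P1" if "p \<in> a_kernel P0 C ?e" for p
  proof -
    have p: "p \<in> carrier P0" and "?e p = \<zero>\<^bsub>C\<^esub>"
      using that unfolding ker by blast+
    then have ep: "\<pi> (\<epsilon> (l0.\<eta> p)) = \<zero>\<^bsub>C\<^esub>" by (simp only: q_epsilon_eq)
    have e: "\<epsilon> (l0.\<eta> p) \<in> carrier X"
      using mod_hom_closed[OF epsilon_hom] l0.\<eta>_mem p by force
    have "\<epsilon> (l0.\<eta> p) \<in> N"
      using N.a_rcos_self[OF e] unfolding ep by (simp add: C_eq quot_module_def)
    then obtain w where "w \<in> carrier (tensor R M X)" and w: "\<epsilon> (l0.\<eta> p) = \<alpha> w" by (rule imageE)
    then obtain v where v: "v \<in> carrier l0.lP" "l0.\<kappa> v = \<zero>\<^bsub>P0\<^esub>" "\<epsilon> v = \<epsilon> (l0.\<eta> p)"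
      unfolding w using N_lift by blast
    \<comment> \<open>Subtracting v moves \<eta>(p) into the kernel of \<epsilon>, which is the
      image of \<delta>, without changing its image p under \<kappa>.\<close>
    have "\<epsilon> (l0.\<eta> p \<ominus>\<^bsub>l0.lP\<^esub> v) = \<zero>\<^bsub>X\<^esub>"
      using v e abelian_group_hom_minus[OF epsilon_additive, of "l0.\<eta> p" v] l0.\<eta>_mem[OF p]
      by (simp add: minus_XA a_minus_def X.M.r_neg)
    then have "l0.\<eta> p \<ominus>\<^bsub>l0.lP\<^esub> v \<in> \<delta> ` carrier l1.lP"
      unfolding exact kerT using v l0.\<eta>_mem[OF p] by simp
    then obtain u where u: "u \<in> carrier l1.lP" "l0.\<eta> p \<ominus>\<^bsub>l0.lP\<^esub> v = \<delta> u" by auto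
    have "p = l0.\<kappa> (l0.\<eta> p \<ominus>\<^bsub>l0.lP\<^esub> v)"
      using v p l0.\<eta>_mem[OF p]
      by (simp add: abelian_group_hom_minus[OF l0.\<kappa>_additive] l0.\<kappa>_\<eta> l0.P.M.minus_eq)
    also have "\<dots> = \<sigma> (l1.\<kappa> u)" using u by (simp add: \<kappa>_\<delta>)
    finally show ?thesis using l1.\<kappa>_mem[OF u(1)] by blast
  qed
  ultimately have "\<sigma> ` carrier P1 = a_kernel P0 C ?e" by blast
  moreover have "?e ` carrier P0 = carrier C"
  proof
    show "carrier C \<subseteq> ?e ` carrier P0"
    proof
      fix c assume "c \<in> carrier C"
      then obtain x where "x \<in> \<epsilon> ` carrier l0.lP" and c: "c = \<pi> x"
        unfolding carrier_C surj by auto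
      then obtain w where w: "w \<in> carrier l0.lP" "c = \<pi> (\<epsilon> w)" by blast
      then have "c = ?e (l0.\<kappa> w)" by (simp add: q_epsilon_\<kappa>)
      then show "c \<in> ?e ` carrier P0" using l0.\<kappa>_mem[OF w(1)] by blast
    qed
  qed (use mod_hom_closed[OF q_epsilon_hom] in blast)
  ultimately show ?thesis
    by (simp add: projective_presentation_def projective_P1 projective_P0 left_module_C
        q_delta_hom q_epsilon_hom)
qed

text \<open>Extension problems correspond under composition with \<eta> and \<kappa>; the square
  \<kappa> \<delta> = \<sigma> \<kappa> turns a solution of one into a solution of the
  other.\<close>

lemma D_class_iff:
  fixes L :: "('r, 'u) module"
  assumes L: "left_module R L"
  shows "L \<in> D_class R P1 \<sigma> P0 \<longleftrightarrow> restrict_scalars fst L \<in> D_class T l1.lP \<delta> l0.lP"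
    (is "_ \<longleftrightarrow> ?Z \<in> _")
proof
  assume D: "L \<in> D_class R P1 \<sigma> P0"
  have "\<exists>g\<in>mod_hom T l0.lP ?Z. \<forall>v\<in>carrier l1.lP. g (\<delta> v) = f v"
    if f: "f \<in> mod_hom T l1.lP ?Z" for f
  proof -
    obtain g where g: "g \<in> mod_hom R P0 L" "\<And>p. p \<in> carrier P1 \<Longrightarrow> g (\<sigma> p) = f (l1.\<eta> p)"
      using D l1.hom_\<eta>[OF f] by (auto simp: D_class_def)
    then have "g (l0.\<kappa> (\<delta> v)) = f v" if "v \<in> carrier l1.lP" for v
      using that l1.hom_factor[OF L f that] by (simp add: \<kappa>_\<delta> l1.\<kappa>_mem)
    then show ?thesis using l0.hom_\<kappa>[OF g(1)] by (intro bexI[of _ "\<lambda>w. g (l0.\<kappa> w)"]) auto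
  qed
  then show "?Z \<in> D_class T l1.lP \<delta> l0.lP"
    using left_module_Z[OF L] by (simp add: D_class_def)
next
  assume D: "?Z \<in> D_class T l1.lP \<delta> l0.lP"
  have "\<exists>g\<in>mod_hom R P0 L. \<forall>p\<in>carrier P1. g (\<sigma> p) = f p"
    if f: "f \<in> mod_hom R P1 L" for f
  proof -
    obtain g where g: "g \<in> mod_hom T l0.lP ?Z" "\<And>v. v \<in> carrier l1.lP \<Longrightarrow> g (\<delta> v) = f (l1.\<kappa> v)"
      using D l1.hom_\<kappa>[OF f] by (auto simp: D_class_def)
    have "g (l0.\<eta> (\<sigma> p)) = f p" if "p \<in> carrier P1" for p
    proof -
      have d: "\<delta> (l1.\<eta> p) \<in> carrier l0.lP"
        using mod_hom_closed[OF delta_hom] l1.\<eta>_mem that by blast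
      show ?thesis
        using l0.hom_factor[OF L g(1) d] g(2)[OF l1.\<eta>_mem[OF that]] that
        by (simp add: q_delta_eq l1.\<kappa>_\<eta>)
    qed
    then show ?thesis using l0.hom_\<eta>[OF g(1)] by (intro bexI[of _ "\<lambda>p. g (l0.\<eta> p)"]) auto
  qed
  then show "L \<in> D_class R P1 \<sigma> P0"
    using L by (simp add: D_class_def)
qed

text \<open>By \<open>Gen_iff\<close> it suffices that the two families of homomorphisms have the
  same images in L, and composing with the surjection \<pi> does not change the image.\<close>

lemma Gen_coker_iff:
  fixes L :: "('r, 'u) module"
  assumes L: "left_module R L"
  shows "L \<in> Gen R C \<longleftrightarrow> restrict_scalars fst L \<in> Gen T XA"
proof -
  let ?Z = "restrict_scalars fst L :: ('r \<times> 'm, 'u) module"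
  have "(\<Union>h\<in>mod_hom R C L. h ` carrier C) = (\<Union>g\<in>mod_hom T XA ?Z. g ` carrier XA)"
  proof (intro equalityI subsetI)
    fix y assume "y \<in> (\<Union>h\<in>mod_hom R C L. h ` carrier C)"
    then obtain h x where h: "h \<in> mod_hom R C L" and "x \<in> carrier X" "y = h (\<pi> x)"
      by (auto simp: carrier_C)
    moreover have "(\<lambda>x. h (\<pi> x)) \<in> mod_hom T XA ?Z"
      by (rule mod_hom_compose[OF \<pi>_hom_XA mod_hom_restrict_scalars[OF fst_ring_hom h]])
    ultimately show "y \<in> (\<Union>g\<in>mod_hom T XA ?Z. g ` carrier XA)" by auto
  next
    fix y assume "y \<in> (\<Union>g\<in>mod_hom T XA ?Z. g ` carrier XA)"
    then obtain g x where g: "g \<in> mod_hom T XA ?Z" and x: "x \<in> carrier X" "y = g x" by auto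
    interpret L: left_module R L by fact
    have gX: "g \<in> mod_hom R X L"
    proof (rule mod_homI)
      \<comment> \<open>The scalar (r, 0) acts on (X, \<alpha>) as r does on X, because 0 \<otimes>
        x = 0.\<close>
      show "g (r \<odot>\<^bsub>X\<^esub> x) = r \<odot>\<^bsub>L\<^esub> g x" if "r \<in> carrier R" "x \<in> carrier X" for r x
        using mod_hom_smult[OF g inclusion_mem[OF that(1)], of x] that
        by (simp add: smult_XA MX.tens_zero_left)
    qed (use mod_hom_closed[OF g] mod_hom_add[OF g] in auto)
    interpret g: abelian_group_hom X L g
      by (rule mod_hom_additive[OF gX X.M.abelian_group_axioms L.M.abelian_group_axioms])
    have "g (\<alpha> w) = \<zero>\<^bsub>L\<^esub>" if "w \<in> carrier (tensor R M X)" for w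
      using that
    proof (induction rule: MX.tensor_induct)
      case (tens m x)
      \<comment> \<open>\<alpha>(m \<otimes> x) is (0, m) x, and (0, m) acts on the restriction of L
        as the zero scalar.\<close>
      then have "g (\<alpha> (tens R M X m x)) = \<zero>\<^bsub>R\<^esub> \<odot>\<^bsub>L\<^esub> g x"
        using mod_hom_smult[OF g, of "(\<zero>\<^bsub>R\<^esub>, m)" x] by (simp add: smult_XA_M carrier_T)
      then show ?case using tens by (simp add: L.smult_zero_left)
    next
      case (minus u v)
      then show ?case
        by (simp add: abelian_group_hom_minus[OF \<alpha>.abelian_group_hom_axioms]
            abelian_group_hom_minus[OF g.abelian_group_hom_axioms] L.M.minus_eq)
    qed simp
    then obtain h where "h \<in> mod_hom R C L" "\<And>x. x \<in> carrier X \<Longrightarrow> h (\<pi> x) = g x"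
      using N.quot_universal[OF L gX] unfolding C_eq by blast
    then show "y \<in> (\<Union>h\<in>mod_hom R C L. h ` carrier C)"
      using x by (auto simp: carrier_C intro!: bexI[of _ h] image_eqI[of _ h "\<pi> x"])
  qed
  moreover have "generate (add_monoid ?Z) S = generate (add_monoid L) S" for S
    by (rule generate_cong) simp_all
  ultimately show ?thesis
    using L left_module_Z[OF L] by (simp add: Gen_iff[OF left_module_C] Gen_iff[OF left_module_XA])
qed

lemma silting_coker:
  assumes "silting TYPE('u) T l1.lP \<delta> l0.lP \<epsilon> XA"
  shows "silting TYPE('u) R P1 \<sigma> P0 (q_epsilon R M \<theta> P0 X \<alpha> \<epsilon>) C"
proof -
  have *: "(Gen T XA :: ('r \<times> 'm, 'u) module set) = D_class T l1.lP \<delta> l0.lP"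
    using assms by (simp add: silting_def)
  have "L \<in> Gen R C \<longleftrightarrow> L \<in> D_class R P1 \<sigma> P0" for L :: "('r, 'u) module"
  \<comment> \<open>The two equivalences speak of modules; a record that is not one lies in neither
    class.\<close>
  proof (cases "left_module R L")
    case True
    then show ?thesis using Gen_coker_iff D_class_iff * by blast
  qed (simp add: Gen_def D_class_def)
  then show ?thesis
    using presentation_coker by (auto simp: silting_def)
qed

text \<open>Each closure property is applied to the restricted modules, which have the same elements
  and hence live in the same universe 'u, and is then read back through
  \<open>D_class_iff\<close>.\<close>

lemma torsion_class_transfer:
  assumes tors: "torsion_class T (D_class T l1.lP \<delta> l0.lP :: ('r \<times> 'm, 'u) module set)"
  shows "torsion_class R (D_class R P1 \<sigma> P0 :: ('r, 'u) module set)"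
proof -
  let ?D = "D_class R P1 \<sigma> P0 :: ('r, 'u) module set"
  let ?DT = "D_class T l1.lP \<delta> l0.lP :: ('r \<times> 'm, 'u) module set"
  let ?Z = "restrict_scalars fst :: ('r, 'u) module \<Rightarrow> ('r \<times> 'm, 'u) module"
  have mod: "left_module R L" if "L \<in> ?D" for L using that by (simp add: D_class_def)
  have Z: "?Z L \<in> ?DT" if "L \<in> ?D" for L using that D_class_iff mod by blast
  have hom: "f \<in> mod_hom T (restrict_scalars fst A) (restrict_scalars fst B)"
    if "f \<in> mod_hom R A B" for f and A :: "('r, 'v) module" and B :: "('r, 'w) module"
    using that by (rule mod_hom_restrict_scalars[OF fst_ring_hom])
  have quot: "N' \<in> ?D" if "L \<in> ?D" "left_module R N'" "f \<in> mod_hom R L N'" "f ` carrier L = carrier N'"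
    for L N' f
  proof -
    have "?Z N' \<in> ?DT"
      using tors Z[OF that(1)] left_module_Z[OF that(2)] hom[OF that(3)] that(4)
      unfolding torsion_class_def by (metis restrict_scalars_simps(1))
    then show ?thesis using D_class_iff that(2) by blast
  qed
  have ext_closed: "N' \<in> ?D"
    if "A \<in> ?D" "B \<in> ?D" "left_module R N'" "f \<in> mod_hom R A N'" "g \<in> mod_hom R N' B"
      "inj_on f (carrier A)" "f ` carrier A = a_kernel N' B g" "g ` carrier N' = carrier B"
    for A B N' f g
  proof -
    have ext: "N'' \<in> ?DT" if "A' \<in> ?DT" "B' \<in> ?DT" "left_module T N''"
        "f \<in> mod_hom T A' N''" "g \<in> mod_hom T N'' B'" "inj_on f (carrier A')"
        "f ` carrier A' = a_kernel N'' B' g" "g ` carrier N'' = carrier B'" for A' B' N''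
      using tors that unfolding torsion_class_def by blast
    \<comment> \<open>The kernel of g depends only on the carrier of its domain and the zero of its
      target, and restriction keeps both.\<close>
    have "?Z N' \<in> ?DT"
      by (rule ext[OF Z[OF that(1)] Z[OF that(2)] left_module_Z[OF that(3)] hom[OF that(4)] hom[OF that(5)]])
        (use that(6-8) in \<open>simp_all add: a_kernel_def'\<close>)
    then show ?thesis using D_class_iff that(3) by blast
  qed
  have sum_closed: "N' \<in> ?D"
    if "\<forall>i\<in>I. L i \<in> ?D" "left_module R N'" "f \<in> mod_hom R (direct_sum I L) N'"
      "bij_betw f (carrier (direct_sum I L)) (carrier N')" for I :: "'u set" and L N' f
  proof -
    have ds: "direct_sum I (\<lambda>i. ?Z (L i)) = restrict_scalars fst (direct_sum I L)"
      by (rule direct_sum_restrict_scalars)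
    have "?Z N' \<in> ?DT"
    proof (rule tors[unfolded torsion_class_def, THEN conjunct2, THEN conjunct2, THEN conjunct2,
          THEN spec, THEN spec, THEN spec, THEN mp, of I "\<lambda>i. ?Z (L i)"], intro conjI bexI[of _ f] ballI)
      show "f \<in> mod_hom T (direct_sum I (\<lambda>i. ?Z (L i))) (?Z N')"
        unfolding ds by (rule hom[OF that(3)])
      show "bij_betw f (carrier (direct_sum I (\<lambda>i. ?Z (L i)))) (carrier (?Z N'))"
        unfolding ds using that(4) by simp
    qed (use Z that(1) left_module_Z[OF that(2)] in blast)+
    then show ?thesis using D_class_iff that(2) by blast
  qed
  show ?thesis
    unfolding torsion_class_def
  proof (intro conjI ballI allI impI; (elim conjE bexE)?)
    show "?D \<subseteq> {L. left_module R L}" using mod by blast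
  qed (fact quot ext_closed sum_closed)+
qed

text \<open>The elements of X and of Coker \<alpha> have different types, and the torsion class is
  given in the universe 'u; closure under quotients therefore comes from the projectivity of l(P1),
  which works across types.\<close>

lemma partial_silting_coker:
  assumes "partial_silting TYPE('u) T l1.lP \<delta> l0.lP \<epsilon> XA"
  shows "partial_silting TYPE('u) R P1 \<sigma> P0 (q_epsilon R M \<theta> P0 X \<alpha> \<epsilon>) C"
proof -
  have "restrict_scalars fst C \<in> D_class T l1.lP \<delta> l0.lP"
  proof (rule D_class_quotient[OF projective_l1 delta_hom _ left_module_Z[OF left_module_C] \<pi>_hom_XA])
    show "XA \<in> D_class T l1.lP \<delta> l0.lP" using assms by (simp add: partial_silting_def)
    show "\<pi> ` carrier XA = carrier (restrict_scalars fst C)" by (simp add: carrier_C)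
  qed
  then have "C \<in> D_class R P1 \<sigma> P0" using D_class_iff[OF left_module_C] by blast
  moreover have "torsion_class R (D_class R P1 \<sigma> P0 :: ('r, 'u) module set)"
    using assms by (intro torsion_class_transfer) (simp add: partial_silting_def)
  ultimately show ?thesis
    using presentation_coker by (simp add: partial_silting_def)
qed

end

theorem proposition4p3:
  fixes R :: "'r ring"
    and M :: "('r, 'r, 'm) bimodule"
    and \<theta> :: "('m \<times> 'm \<Rightarrow>\<^sub>0 int) set \<Rightarrow> 'm"
    and X :: "('r, 'x) module"
    and \<alpha> :: "('m \<times> 'x \<Rightarrow>\<^sub>0 int) set \<Rightarrow> 'x"
    and P1 :: "('r, 'y) module"
    and P0 :: "('r, 'z) module"
    and \<delta> :: "(('r \<times> 'm) \<times> 'y \<Rightarrow>\<^sub>0 int) set \<Rightarrow> (('r \<times> 'm) \<times> 'z \<Rightarrow>\<^sub>0 int) set"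
    and \<epsilon> :: "(('r \<times> 'm) \<times> 'z \<Rightarrow>\<^sub>0 int) set \<Rightarrow> 'x"
  assumes "ring R" and "\<one>\<^bsub>R\<^esub> \<noteq> \<zero>\<^bsub>R\<^esub>"
    and "bimodule R R M"
    and "\<theta> \<in> bimod_hom R R (tensor_bimodule R M M) M"
    and "theta_associative R M \<theta>"
    and "theta_pair R M \<theta> X \<alpha>"
    and "projective R P1" and "projective R P0"
    and "projective_presentation (theta_ext R M \<theta>)
           (l_fun R M \<theta> P1) \<delta> (l_fun R M \<theta> P0) \<epsilon> (pair_module R M X \<alpha>)"
  shows
    "(silting TYPE('u) (theta_ext R M \<theta>)
        (l_fun R M \<theta> P1) \<delta> (l_fun R M \<theta> P0) \<epsilon> (pair_module R M X \<alpha>)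
      \<longrightarrow> silting TYPE('u) R
        P1 (q_delta R M \<theta> P1 P0 \<delta>) P0 (q_epsilon R M \<theta> P0 X \<alpha> \<epsilon>) (coker (tensor R M X) X \<alpha>)) \<and>
     (partial_silting TYPE('u) (theta_ext R M \<theta>)
        (l_fun R M \<theta> P1) \<delta> (l_fun R M \<theta> P0) \<epsilon> (pair_module R M X \<alpha>)
      \<longrightarrow> partial_silting TYPE('u) R
        P1 (q_delta R M \<theta> P1 P0 \<delta>) P0 (q_epsilon R M \<theta> P0 X \<alpha> \<epsilon>) (coker (tensor R M X) X \<alpha>))"
proof -
  \<comment> \<open>Projectivity over T includes being a T-module, and a module brings the ring
    axioms of its scalars with it; this is where the locales below get that T is a ring.\<close>
  have l: "left_module (theta_ext R M \<theta>) (l_fun R M \<theta> P1)" "left_module (theta_ext R M \<theta>) (l_fun R M \<theta> P0)"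
    using assms(9) by (simp_all add: projective_presentation_def projective_def)
  have P: "left_module R P1" "left_module R P0" using assms(7,8) by (simp_all add: projective_def)
  have X: "left_module R X" "\<alpha> \<in> mod_hom R (tensor R M X) X"
    using assms(6) by (simp_all add: theta_pair_def)
  interpret T: theta_extension R M \<theta>
    by (intro theta_extension.intro theta_extension_axioms.intro assms(3,4) left_module.axioms(1)[OF l(1)])
  interpret theta_presentation R M \<theta> X P1 P0 \<alpha> \<delta> \<epsilon>
    by (intro theta_presentation.intro theta_presentation_axioms.intro l_setting.intro
        l_setting_axioms.intro T.theta_extension_axioms l P X assms(7-9))
  show ?thesis using silting_coker partial_silting_coker by blast
qed

end
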